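(* Let $0<d<\pi/2$, $\mathscr{D}_d=\{\zeta\in\mathbb{C}:|\Im\zeta|<d\}$, and $\psi(t)=e^{(\pi/2)\sinh t}$. Assume $f$ is analytic on $\psi(\mathscr{D}_d)$ and there are constants $K,\alpha,\beta>0$ with $|f(z)|\le K\left|\frac{z^{\alpha-1}}{(1+z^2)^{(\alpha+\beta)/2}}\right|$ for all $z\in\psi(\mathscr{D}_d)$. Let $\mu=\min\{\alpha,\beta\}$, $\nu=\max\{\alpha,\beta\}$, let $n$ be a positive integer, $h=\log(8dn/\mu)/n$, and let $M=n$, $N=n-\lfloor\log(\beta/\alpha)/h\rfloor$ if $\mu=\alpha$, and $N=n$, $M=n-\lfloor\log(\alpha/\beta)/h\rfloor$ if $\mu=\beta$. Suppose $n\ge\nu e/(8d)$, $Mh\ge x_{\alpha/2}$ and $Nh\ge x_{\beta/2}$. Then \[ \left|\int_{0}^{\infty}f(t)\,dt-h\sum_{k=-M}^{N}f(\psi(kh))\psi'(kh)\right|\le C_2e^{-2\pi dn/\log(8dn/\mu)}, \] with $C_2=\frac{2K}{\mu}\left\{\frac{2}{(1-e^{-\pi\mu e/4})\{\cos(\frac{\pi}{2}\sin d)\}^{(\alpha+\beta)/2}\cos d}+e^{\pi\nu/4}\right\}$.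
   Context: For $\gamma>0$, $x_\gamma=\operatorname{arcsinh}\!\left(\frac{\sqrt{1+\sqrt{1-(2\pi\gamma)^2}}}{2\pi\gamma}\right)$ if $0<\gamma<1/(2\pi)$, and $x_\gamma=\operatorname{arcsinh}(1)$ if $\gamma\ge1/(2\pi)$. Complex powers use principal branches. *)

theory Defs
  imports "HOL-Analysis.Analysis"
begin

definition strip :: "real \<Rightarrow> complex set" where
  "strip d = {\<zeta>. \<bar>Im \<zeta>\<bar> < d}"

definition psi :: "complex \<Rightarrow> complex" where
  "psi t = exp (of_real (pi/2) * sinh t)"

definition psi' :: "real \<Rightarrow> real" where
  "psi' t = (pi/2) * cosh t * exp ((pi/2) * sinh t)"

definition x_gamma :: "real \<Rightarrow> real" where
  "x_gamma \<gamma> = (if 0 < \<gamma> \<and> \<gamma> < 1/(2*pi)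
     then arsinh (sqrt (1 + sqrt (1 - (2*pi*\<gamma>)^2)) / (2*pi*\<gamma>))
     else arsinh 1)"

end

theory Submission
  imports Defs "HOL-Complex_Analysis.Complex_Analysis" "HOL-Real_Asymp.Real_Asymp"
begin

text \<open>
  After the substitution \<open>t = psi x\<close> the integrand \<open>F x = f (psi x) * psi' x\<close> is holomorphic on the
  strip. Since \<open>|1 + exp (pi * sinh (x + iy))| \<ge> (1 + exp (pi * sinh x * cos y)) * cos (pi/2 * sin y)\<close>,
  it is dominated there by a multiple of \<open>cosh x * exp (- \<kappa> * |sinh x|)\<close>, whose integral is explicit.

  Discretization error: integrating \<open>F z / (exp (2*pi*i*z/h) - 1)\<close> around a rectangle of height
  \<open>2 * \<delta>\<close>, \<open>\<delta> < d\<close>, turns the trapezoidal sum into integrals over the lines \<open>Im z = \<plusminus> \<delta>\<close>; comparison with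
  the integral of \<open>F\<close> leaves a kernel of modulus at most \<open>1 / (exp (2*pi*\<delta>/h) - 1)\<close>. Then let \<open>\<delta> \<rightarrow> d\<close>.

  Truncation error: the terms beyond \<open>N\<close> are bounded by a telescoping sum, which gives a constant
  times \<open>exp (- pi/2 * \<beta> * sinh (N * h))\<close>, and \<open>exp (N * h) \<ge> 8 * d * n / \<beta>\<close> by the choice of \<open>N\<close>;
  likewise for \<open>M\<close> and \<open>\<alpha>\<close>.
\<close>

section \<open>A lower bound for the denominator\<close>

text \<open>Two linear estimates meet here: \<open>cos t\<close> is at most \<open>pi/2 - t\<close>,
  and by concavity \<open>sin t\<close> lies above its chord \<open>2 * t / pi\<close>. The factor
  \<open>pi/2 + t\<close> makes up for the slope, since
  \<open>(pi/2 + t) * (2 / pi) \<ge> 1\<close>.\<close>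

lemma mult_cos_le_mult_sin:
  fixes t :: real
  assumes "0 \<le> t" "t \<le> pi/2"
  shows "t * cos t \<le> ((pi/2)\<^sup>2 - t\<^sup>2) * sin t"
proof -
  have 1: "cos t \<le> pi/2 - t"
    using sin_x_le_x[of "pi/2 - t"] assms by (simp add: sin_diff)
  have "convex_on {0..pi} (\<lambda>x. - sin x)"
    by (rule f''_ge0_imp_convex[where f' = "\<lambda>x. - cos x" and f'' = sin])
       (auto intro!: derivative_eq_intros sin_ge_zero)
  then have "- sin ((1 - 2 * t / pi) *\<^sub>R 0 + (2 * t / pi) *\<^sub>R (pi/2))
      \<le> (1 - 2 * t / pi) * (- sin 0) + 2 * t / pi * (- sin (pi/2))"
    using assms by (intro convex_onD) (auto simp: field_simps)
  then have 2: "2 * t / pi \<le> sin t" by simp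
  have "t * cos t \<le> (pi/2 - t) * t"
    using 1 assms by (simp add: mult.commute mult_left_mono)
  also have "\<dots> \<le> (pi/2 - t) * ((pi/2 + t) * (2 * t / pi))"
    using assms by (intro mult_left_mono) (auto simp: field_simps)
  also have "\<dots> \<le> (pi/2 - t) * ((pi/2 + t) * sin t)"
    using assms 2 by (intro mult_left_mono) auto
  also have "\<dots> = ((pi/2)\<^sup>2 - t\<^sup>2) * sin t"
    unfolding power2_eq_square square_diff_square_factored by (simp only: mult_ac)
  finally show ?thesis .
qed

section \<open>Elementary estimates for hyperbolic functions\<close>

lemma Re_sinh: "Re (sinh z) = sinh (Re z) * cos (Im z)"
  and Im_sinh: "Im (sinh z) = cosh (Re z) * sin (Im z)"
  by (auto simp: sinh_field_def cosh_field_def Re_exp Im_exp field_simps)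

lemma cmod_cosh_le: "cmod (cosh z) \<le> cosh (Re z)"
proof -
  have "cmod (exp z + exp (-z)) \<le> exp (Re z) + exp (- Re z)"
    using norm_triangle_ineq[of "exp z" "exp (-z)"] by simp
  then show ?thesis by (simp add: cosh_field_def norm_divide)
qed

lemma le_sinh_real:
  fixes x :: real
  assumes "0 \<le> x"
  shows "x \<le> sinh x"
proof -
  have "sinh 0 - 0 \<le> sinh x - x"
    using assms
    by (intro DERIV_nonneg_imp_nondecreasing[of 0 x "\<lambda>x. sinh x - x"])
       (auto intro!: derivative_eq_intros exI simp: cosh_real_ge_1)
  then show ?thesis by simp
qed

lemma one_add_half_square_le_cosh: "1 + x\<^sup>2 / 2 \<le> cosh (x :: real)"
proof -
  have "cosh x = 1 + 2 * (sinh (x/2))\<^sup>2"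
    using cosh_double_cosh[of "x/2"] by (simp add: cosh_square_eq)
  moreover have "\<bar>x/2\<bar>\<^sup>2 \<le> (sinh \<bar>x/2\<bar>)\<^sup>2"
    by (intro power_mono le_sinh_real) auto
  moreover have "(sinh \<bar>x/2\<bar>)\<^sup>2 = (sinh (x/2))\<^sup>2"
    by (simp add: abs_if)
  ultimately show ?thesis by (simp add: power_divide)
qed

text \<open>Put X for \<open>pi^2/4 - t^2\<close>. Expanding \<open>sin (t + (c - 1) * t)\<close>
  and trading \<open>t * cos t\<close> for \<open>X * sin t\<close> leaves the factor
  \<open>1 + (c - 1) * X\<close>. It is at most \<open>1 + (c^2 - 1) * X / 2\<close>, the quadratic
  part of cosh. The form is made for \<open>c = cosh x\<close> and \<open>t = pi/2 * sin y\<close>,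
  where the two roots become \<open>\<bar>sinh x\<bar>\<close> and
  \<open>pi/2 * cos y\<close>.\<close>

lemma sin_mult_le_sin_mult_cosh:
  fixes c t :: real
  assumes c: "1 \<le> c" and t: "0 < t" "c * t \<le> pi/2" 
  shows "sin (c * t) \<le> sin t * cosh (sqrt (c\<^sup>2 - 1) * sqrt ((pi/2)\<^sup>2 - t\<^sup>2))"
proof -
  have tp: "t \<le> pi/2" using mult_right_mono[of 1 c t] c t by linarith
  have "c * t = t + (c - 1) * t" by (simp add: algebra_simps)
  then have "sin (c * t) = sin t * cos ((c - 1) * t) + cos t * sin ((c - 1) * t)"
    by (metis sin_add)
  also have "\<dots> \<le> sin t * 1 + cos t * ((c - 1) * t)"
    using c t tp by (intro add_mono mult_left_mono sin_x_le_x sin_ge_zero cos_ge_zero) auto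
  also have "\<dots> \<le> sin t * 1 + (c - 1) * (((pi/2)\<^sup>2 - t\<^sup>2) * sin t)"
    using mult_left_mono[OF mult_cos_le_mult_sin[of t], of "c - 1"] c t tp by (simp add: mult_ac)
  also have "\<dots> = sin t * (1 + (c - 1) * ((pi/2)\<^sup>2 - t\<^sup>2))"
    by (simp add: algebra_simps)
  also have "\<dots> \<le> sin t * (1 + (sqrt (c\<^sup>2 - 1) * sqrt ((pi/2)\<^sup>2 - t\<^sup>2))\<^sup>2 / 2)"
  proof -
    have a: "0 \<le> (pi/2)\<^sup>2 - t\<^sup>2" using t tp by (simp add: power_mono)
    have "2 * (c - 1) \<le> (c - 1) * (c + 1)"
      using mult_left_mono[of 2 "c + 1" "c - 1"] c by (simp add: mult.commute)
    then have b: "2 * (c - 1) \<le> c\<^sup>2 - 1" by (simp add: algebra_simps power2_eq_square)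
    have "(c - 1) * ((pi/2)\<^sup>2 - t\<^sup>2) \<le> (c\<^sup>2 - 1) * ((pi/2)\<^sup>2 - t\<^sup>2) / 2"
      using mult_right_mono[OF b a] by (simp add: algebra_simps)
    moreover have "0 \<le> c\<^sup>2 - 1" using one_le_power[OF c, of 2] by simp
    ultimately show ?thesis
      using a t tp by (intro mult_left_mono sin_ge_zero) (auto simp: power_mult_distrib)
  qed
  also have "\<dots> \<le> sin t * cosh (sqrt (c\<^sup>2 - 1) * sqrt ((pi/2)\<^sup>2 - t\<^sup>2))"
    using t tp by (intro mult_left_mono one_add_half_square_le_cosh sin_ge_zero) auto
  finally show ?thesis .
qed

text \<open>The arguments of the first sine and of cosh are the imaginary and the real part of
  \<open>pi/2 * sinh (x + iy)\<close>. The bound says how far \<open>exp (pi * sinh z)\<close> can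
  turn towards -1 for a given modulus. By symmetry it is enough to treat positive
  \<open>y\<close>.\<close>

lemma abs_sin_cosh_sin_le:
  fixes x y :: real
  assumes y: "\<bar>y\<bar> \<le> pi/2"
  shows "\<bar>sin (pi/2 * (cosh x * sin y))\<bar> \<le> \<bar>sin (pi/2 * sin y)\<bar> * cosh (pi/2 * (sinh x * cos y))"
proof -
  have main: "\<bar>sin (pi/2 * (cosh x * sin y))\<bar> \<le> sin (pi/2 * sin y) * cosh (pi/2 * (sinh x * cos y))"
    if y: "0 < y" "y \<le> pi/2" for y
  proof -
    define p t where "p = sin y" and "t = pi/2 * p"
    have p: "0 < p" "p \<le> 1" using y by (auto simp: p_def sin_gt_zero)
    have t: "0 < t" "t \<le> pi/2" using p by (auto simp: t_def)
    have "(pi/2)\<^sup>2 - t\<^sup>2 = (pi/2 * cos y)\<^sup>2"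
      unfolding t_def p_def power_mult_distrib cos_squared_eq by algebra
    moreover have cy: "0 \<le> cos y" using y by (intro cos_ge_zero) auto
    ultimately have sq: "sqrt ((pi/2)\<^sup>2 - t\<^sup>2) = pi/2 * cos y" by simp
    have c1: "1 \<le> cosh x" by (rule cosh_real_ge_1)
    have sc: "sqrt ((cosh x)\<^sup>2 - 1) = \<bar>sinh x\<bar>" by (simp add: cosh_square_eq)
    have arg: "pi/2 * (cosh x * sin y) = cosh x * t" by (simp add: t_def p_def)
    have st: "0 \<le> sin t" using t by (intro sin_ge_zero) auto
    have ch: "cosh (pi/2 * (sinh x * cos y)) = cosh (\<bar>sinh x\<bar> * (pi/2 * cos y))"
    proof -
      have "\<bar>pi/2 * (sinh x * cos y)\<bar> = \<bar>sinh x\<bar> * (pi/2 * cos y)"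
        using cy by (simp add: abs_mult)
      then show ?thesis by (metis cosh_real_abs)
    qed
    show ?thesis
    proof (cases "cosh x * t \<le> pi/2")
      case True
      have "0 \<le> sin (cosh x * t)" using True t c1 by (intro sin_ge_zero) auto
      with sin_mult_le_sin_mult_cosh[OF c1 t(1) True] show ?thesis
        unfolding arg ch sq sc by (simp add: t_def p_def)
    next
      case False
      \<comment> \<open>the right-hand side grows with \<open>cosh x\<close>, so the worst case is \<open>cosh x = 1 / p\<close>\<close>
      have tt: "(1/p) * t = pi/2" using p by (simp add: t_def)
      have c2: "1 / p \<le> cosh x" using False p by (simp add: t_def field_simps)
      have "1 = sin ((1/p) * t)" unfolding tt by simp
      also have "\<dots> \<le> sin t * cosh (sqrt ((1/p)\<^sup>2 - 1) * (pi/2 * cos y))"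
        using sin_mult_le_sin_mult_cosh[of "1/p" t] p t tt sq by simp
      also have "\<dots> \<le> sin t * cosh (\<bar>sinh x\<bar> * (pi/2 * cos y))"
      proof (intro mult_left_mono st)
        have "sqrt ((1/p)\<^sup>2 - 1) \<le> \<bar>sinh x\<bar>"
          unfolding sc[symmetric] using c2 p by (intro real_sqrt_le_mono diff_right_mono power_mono) auto
        moreover have "1 \<le> (1/p)\<^sup>2" using p by simp
        ultimately show "cosh (sqrt ((1/p)\<^sup>2 - 1) * (pi/2 * cos y)) \<le> cosh (\<bar>sinh x\<bar> * (pi/2 * cos y))"
          using cy by (subst cosh_real_nonneg_le_iff) (auto intro!: mult_right_mono)
      qed
      finally show ?thesis
        unfolding ch t_def p_def using abs_sin_le_one order_trans by blast
    qed
  qed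
  consider "y = 0" | "0 < y" | "y < 0" by linarith
  then show ?thesis
  proof cases
    case 2
    then have "\<bar>sin (pi/2 * (cosh x * sin y))\<bar> \<le> sin (pi/2 * sin y) * cosh (pi/2 * (sinh x * cos y))"
      using main y by simp
    also have "\<dots> \<le> \<bar>sin (pi/2 * sin y)\<bar> * cosh (pi/2 * (sinh x * cos y))"
      by (intro mult_right_mono) auto
    finally show ?thesis .
  next
    case 3
    then have "\<bar>sin (pi/2 * (cosh x * sin y))\<bar> \<le> (- sin (pi/2 * sin y)) * cosh (pi/2 * (sinh x * cos y))"
      using main[of "-y"] y by simp
    also have "\<dots> \<le> \<bar>sin (pi/2 * sin y)\<bar> * cosh (pi/2 * (sinh x * cos y))"
      by (intro mult_right_mono) auto
    finally show ?thesis .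
  qed simp
qed

lemma cos_half_pi_sin_pos:
  assumes "\<bar>y\<bar> < pi/2"
  shows "0 < cos (pi/2 * sin y)"
proof -
  have "\<bar>sin y\<bar> < 1"
    using sin_monotone_2pi[of y "pi/2"] sin_monotone_2pi[of "-(pi/2)" y] assms
    by (simp add: abs_less_iff)
  then have "\<bar>pi/2 * sin y\<bar> < pi/2" by (simp add: abs_mult)
  then show ?thesis
    by (intro cos_gt_zero_pi) linarith+
qed

text \<open>With \<open>a + ib = pi * sinh z\<close> the squared modulus is
  \<open>(1 + exp a)^2 - 4 * exp a * (sin (b/2))^2\<close>. Since
  \<open>4 * exp a * (cosh (a/2))^2 = (1 + exp a)^2\<close>, \<open>abs_sin_cosh_sin_le\<close>
  bounds the subtracted term by the fraction \<open>(sin p)^2\<close> of the first one, and the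
  fraction \<open>(cos p)^2\<close> remains.\<close>

lemma norm_one_add_exp_sinh_ge:
  assumes y: "\<bar>Im z\<bar> < pi/2"
  shows "(1 + exp (pi * Re (sinh z))) * cos (pi/2 * sin (Im z)) \<le> cmod (1 + exp (of_real pi * sinh z))"
proof -
  define a b p where "a = pi * Re (sinh z)" and "b = pi * Im (sinh z)" and "p = pi/2 * sin (Im z)"
  have cp: "0 < cos p" using cos_half_pi_sin_pos[OF y] by (simp add: p_def)
  have "\<bar>sin (b/2)\<bar> \<le> \<bar>sin p\<bar> * cosh (a/2)"
    using abs_sin_cosh_sin_le[of "Im z" "Re z"] y
    by (simp add: a_def b_def p_def Re_sinh Im_sinh mult_ac)
  then have "(sin (b/2))\<^sup>2 \<le> (\<bar>sin p\<bar> * cosh (a/2))\<^sup>2"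
    by (metis abs_ge_zero power2_abs power_mono)
  then have *: "4 * exp a * (sin (b/2))\<^sup>2 \<le> 4 * exp a * ((sin p)\<^sup>2 * (cosh (a/2))\<^sup>2)"
    by (simp add: power_mult_distrib)
  have ea: "exp a = exp (a/2) * exp (a/2)" by (simp flip: exp_add)
  have ch: "4 * exp a * (cosh (a/2))\<^sup>2 = (1 + exp a)\<^sup>2"
    unfolding ea cosh_field_def by (simp add: power2_eq_square field_simps exp_minus)
  have cb: "cos b = 1 - 2 * (sin (b/2))\<^sup>2"
    using cos_double_sin[of "b/2"] by simp
  have sq: "(cmod (1 + exp (of_real pi * sinh z)))\<^sup>2 = (1 + exp a * cos b)\<^sup>2 + (exp a * sin b)\<^sup>2"
    by (simp add: cmod_power2 Re_exp Im_exp a_def b_def)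
  also have "\<dots> = 1 + 2 * exp a * cos b + (exp a)\<^sup>2 * ((sin b)\<^sup>2 + (cos b)\<^sup>2)"
    by algebra
  also have "\<dots> = (1 + exp a)\<^sup>2 - 4 * exp a * (sin (b/2))\<^sup>2"
    using sin_cos_squared_add[of b] cb by algebra
  also have "\<dots> \<ge> (1 + exp a)\<^sup>2 - (sin p)\<^sup>2 * (1 + exp a)\<^sup>2"
    using * by (simp add: ch[symmetric] mult_ac)
  also have "(1 + exp a)\<^sup>2 - (sin p)\<^sup>2 * (1 + exp a)\<^sup>2 = ((1 + exp a) * cos p)\<^sup>2"
    unfolding power_mult_distrib cos_squared_eq by algebra
  finally show ?thesis
    unfolding a_def[symmetric] p_def[symmetric] by (rule power2_le_imp_le) simp
qed

section \<open>The trapezoidal rule in a strip\<close>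

lemma contour_integral_linepath_same_Im:
  assumes "a < b"
  shows "contour_integral (linepath (Complex a y) (Complex b y)) F = integral {a..b} (\<lambda>x. F (Complex x y))"
proof -
  define G where "G = (\<lambda>z. F (z + Complex 0 y))"
  have "linepath (Complex a y) (Complex b y) x = linepath (of_real a) (of_real b) x + Complex 0 y" for x
    by (simp add: linepath_def complex_eq_iff algebra_simps)
  moreover have "Complex b y - Complex a y = of_real b - of_real a"
    by (simp add: complex_eq_iff)
  ultimately have "contour_integral (linepath (Complex a y) (Complex b y)) F
      = contour_integral (linepath (of_real a) (of_real b)) G"
    by (simp add: contour_integral_integral G_def)
  also have "\<dots> = integral {a..b} (\<lambda>x. G (of_real x))"
    using assms by (subst contour_integral_linepath_Reals_eq) auto
  also have "\<dots> = integral {a..b} (\<lambda>x. F (Complex x y))"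
    by (simp add: G_def complex_of_real_def complex_add)
  finally show ?thesis .
qed

text \<open>The horizontal sides become integrals over a real variable, because they are compared
  with each other later. The vertical sides stay contour integrals, both directed upwards, and will
  only be estimated.\<close>

lemma contour_integral_rectpath_eq:
  fixes F :: "complex \<Rightarrow> complex"
  assumes ab: "a < b" and ce: "c < e"
    and cont: "continuous_on (path_image (rectpath (Complex a c) (Complex b e))) F"
  shows "contour_integral (rectpath (Complex a c) (Complex b e)) F =
      integral {a..b} (\<lambda>x. F (Complex x c)) + contour_integral (linepath (Complex b c) (Complex b e)) F
    - integral {a..b} (\<lambda>x. F (Complex x e)) - contour_integral (linepath (Complex a c) (Complex a e)) F"
proof -
  have P: "path_image (rectpath (Complex a c) (Complex b e)) =
      closed_segment (Complex a c) (Complex b c) \<union> closed_segment (Complex b c) (Complex b e)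
      \<union> closed_segment (Complex b e) (Complex a e) \<union> closed_segment (Complex a e) (Complex a c)"
    by (simp add: rectpath_def Let_def path_image_join Un_assoc)
  have C: "continuous_on (closed_segment (Complex a c) (Complex b c)) F"
    "continuous_on (closed_segment (Complex b c) (Complex b e)) F"
    "continuous_on (closed_segment (Complex b e) (Complex a e)) F"
    "continuous_on (closed_segment (Complex a e) (Complex a c)) F"
    using cont unfolding P by (auto intro: continuous_on_subset)
  have I: "F contour_integrable_on linepath (Complex a c) (Complex b c)"
    "F contour_integrable_on linepath (Complex b c) (Complex b e)"
    "F contour_integrable_on linepath (Complex b e) (Complex a e)"
    "F contour_integrable_on linepath (Complex a e) (Complex a c)"
    using C by (auto intro: contour_integrable_continuous_linepath)
  have "contour_integral (rectpath (Complex a c) (Complex b e)) F =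
      contour_integral (linepath (Complex a c) (Complex b c)) F
    + contour_integral (linepath (Complex b c) (Complex b e)) F
    + contour_integral (linepath (Complex b e) (Complex a e)) F
    + contour_integral (linepath (Complex a e) (Complex a c)) F"
    by (simp add: rectpath_def Let_def I)
  also have "contour_integral (linepath (Complex b e) (Complex a e)) F
      = - contour_integral (linepath (Complex a e) (Complex b e)) F"
    using C(3) by (rule contour_integral_reverse_linepath)
  also have "contour_integral (linepath (Complex a e) (Complex a c)) F
      = - contour_integral (linepath (Complex a c) (Complex a e)) F"
    using C(4) by (rule contour_integral_reverse_linepath)
  finally show ?thesis
    using ab by (simp add: contour_integral_linepath_same_Im)
qed

section \<open>Poles and residues of the kernel \<open>1 / (exp (2*pi*i*z/h) - 1)\<close>\<close>

lemma exp_two_pi_i_div_eq_1_iff: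
  fixes h :: real
  assumes "h \<noteq> 0"
  shows "exp (2 * of_real pi * \<i> * z / of_real h) = 1 \<longleftrightarrow> (\<exists>k::int. z = of_real (of_int k * h))"
proof -
  have "exp (2 * of_real pi * \<i> * z / of_real h) = 1 \<longleftrightarrow>
     Im z = 0 \<and> (\<exists>k::int. Re z = of_int k * h)"
    using assms by (simp add: exp_eq_1 field_simps)
  also have "\<dots> \<longleftrightarrow> (\<exists>k::int. z = of_real (of_int k * h))"
    by (auto simp: complex_eq_iff)
  finally show ?thesis .
qed

text \<open>The kernel has residue \<open>h / (2*pi*i)\<close> at each multiple of \<open>h\<close>,
  so \<open>2*pi*i\<close> times the sum of residues is exactly a trapezoidal sum.\<close>

lemma residue_divide_exp_two_pi_i_minus_1:
  fixes h :: real and k :: int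
  assumes h: "h > 0" and S: "open S" "of_real (of_int k * h) \<in> S" and F: "F holomorphic_on S"
  shows "residue (\<lambda>z. F z / (exp (2 * of_real pi * \<i> * z / of_real h) - 1)) (of_real (of_int k * h))
    = F (of_real (of_int k * h)) * (of_real h / (2 * of_real pi * \<i>))"
proof -
  define c where "c = 2 * of_real pi * \<i> / complex_of_real h"
  define p where "p = complex_of_real (of_int k * h)"
  have c0: "c \<noteq> 0" using h by (simp add: c_def)
  have E: "exp (2 * of_real pi * \<i> * z / of_real h) = exp (c * z)" for z
    by (simp add: c_def)
  have ep: "exp (c * p) = 1"
    using exp_two_pi_i_div_eq_1_iff[of h p] h unfolding E by (auto simp: p_def)
  \<comment> \<open>Neighbouring poles are \<open>h\<close> apart, so the open ball of radius
    \<open>h\<close> contains no pole except its centre.\<close>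
  define T where "T = S \<inter> ball p h"
  have T: "open T" "p \<in> T" using S h by (auto simp: T_def p_def)
  have nz: "exp (c * z) - 1 \<noteq> 0" if "z \<in> T - {p}" for z
  proof
    assume "exp (c * z) - 1 = 0"
    then obtain j :: int where j: "z = of_real (of_int j * h)"
      using exp_two_pi_i_div_eq_1_iff[of h z] h unfolding E by auto
    have "p - z = of_real (of_int (k - j) * h)" by (simp add: j p_def algebra_simps)
    then have "dist p z = \<bar>of_int (k - j)\<bar> * h"
      using h by (simp only: dist_norm norm_of_real) (simp add: abs_mult)
    moreover have "dist p z < h" using that by (auto simp: T_def)
    ultimately have "\<bar>real_of_int (k - j)\<bar> < 1" using h by simp
    then have "k = j" by linarith
    with j that show False by (auto simp: p_def)
  qed
  have "residue (\<lambda>z. F z / (exp (c * z) - 1)) p = F p * (1 / c)"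
  proof (rule residue_simple'[OF T])
    show "(\<lambda>z. F z / (exp (c * z) - 1)) holomorphic_on T - {p}"
      using F nz by (intro holomorphic_intros) (auto simp: T_def intro: holomorphic_on_subset)
    have "((\<lambda>z. exp (c * z)) has_field_derivative c) (at p)"
      using ep by (auto intro!: derivative_eq_intros)
    then have "((\<lambda>z. (exp (c * z) - 1) / (z - p)) \<longlongrightarrow> c) (at p)"
      by (simp add: has_field_derivative_iff ep)
    moreover have "isCont F p"
      using F S by (metis continuous_on_eq_continuous_at holomorphic_on_imp_continuous_on p_def)
    ultimately have "((\<lambda>z. F z * (1 / ((exp (c * z) - 1) / (z - p)))) \<longlongrightarrow> F p * (1 / c)) (at p)"
      using c0 by (intro tendsto_intros) (auto simp: isCont_def)
    then show "((\<lambda>z. F z / (exp (c * z) - 1) * (z - p)) \<longlongrightarrow> F p * (1 / c)) (at p)"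
      by simp
  qed
  then show ?thesis
    unfolding E by (simp add: c_def p_def)
qed

lemma open_strip: "open (strip d)"
proof -
  have "strip d = {z. \<bar>Im z\<bar> < d}" by (simp add: strip_def)
  then show ?thesis by (simp add: open_Collect_less continuous_intros)
qed

lemma convex_strip: "convex (strip d)"
proof -
  have "strip d = {z. Im z < d} \<inter> {z. Im z > -d}" by (auto simp: strip_def)
  then show ?thesis by (simp add: convex_Int convex_halfspace_Im_lt convex_halfspace_Im_gt)
qed

text \<open>Half-integer multiples of \<open>h\<close> lie midway between poles, so the vertical
  sides avoid them and the rectangle encloses exactly those with
  \<open>\<bar>k\<bar> \<le> m\<close>, each with winding number 1.\<close>

lemma contour_integral_rectpath_eq_trapezoidal_sum:
  fixes h \<delta> d :: real and m :: nat
  assumes h: "0 < h" and \<delta>: "0 < \<delta>" "\<delta> < d" and F: "F holomorphic_on strip d"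
  defines "a \<equiv> (real m + 1/2) * h"
  shows "contour_integral (rectpath (Complex (-a) (-\<delta>)) (Complex a \<delta>))
      (\<lambda>z. F z / (exp (2 * of_real pi * \<i> * z / of_real h) - 1))
    = of_real h * (\<Sum>k\<in>{-int m..int m}. F (of_real (of_int k * h)))"
proof -
  let ?g = "\<lambda>z. F z / (exp (2 * of_real pi * \<i> * z / of_real h) - 1)"
  let ?P = "\<lambda>k::int. complex_of_real (of_int k * h)"
  let ?R = "rectpath (Complex (-a) (-\<delta>)) (Complex a \<delta>)"
  \<comment> \<open>The window reaches up to the next poles at
    \<open>\<plusminus> (m + 1) * h\<close> but excludes them: it contains the closed rectangle and
    only the enclosed poles.\<close>
  define S where "S = strip d \<inter> ({z. Re z < (real m + 1) * h} \<inter> {z. Re z > - ((real m + 1) * h)})"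
  have a: "0 < a" "a < (real m + 1) * h" using h by (auto simp: a_def)
  have S: "open S" "convex S"
    by (auto simp: S_def intro!: open_Int convex_Int open_strip convex_strip open_halfspace_Re_lt
        open_halfspace_Re_gt convex_halfspace_Re_lt convex_halfspace_Re_gt)
  have FS: "F holomorphic_on S" using F by (rule holomorphic_on_subset) (auto simp: S_def)
  have inj: "inj_on ?P {-int m..int m}"
    using h by (auto simp: inj_on_def)
  have kbox: "?P k \<in> box (Complex (-a) (-\<delta>)) (Complex a \<delta>)" if "k \<in> {-int m..int m}" for k
  proof -
    have "\<bar>real_of_int k\<bar> \<le> real m" using that by auto
    then have "\<bar>real_of_int k\<bar> < real m + 1/2" by simp
    then have "\<bar>real_of_int k * h\<bar> < a" using h by (simp add: a_def abs_mult)
    then show ?thesis using \<delta> by (auto simp: in_box_complex_iff)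
  qed
  have RS: "cbox (Complex (-a) (-\<delta>)) (Complex a \<delta>) \<subseteq> S"
    using a \<delta> by (auto simp: in_cbox_complex_iff S_def strip_def)
  have poles: "z \<in> ?P ` {-int m..int m}"
    if z: "z \<in> S" "exp (2 * of_real pi * \<i> * z / of_real h) = 1" for z
  proof -
    obtain k :: int where k: "z = ?P k" using z h exp_two_pi_i_div_eq_1_iff by auto
    have "\<bar>real_of_int k * h\<bar> < (real m + 1) * h" using z by (auto simp: S_def k)
    then have "\<bar>real_of_int k\<bar> < real m + 1" using h by (simp add: abs_mult)
    then show ?thesis using k by (auto intro!: imageI)
  qed
  have "contour_integral ?R ?g = 2 * pi * \<i> * (\<Sum>p\<in>?P ` {-int m..int m}. winding_number ?R p * residue ?g p)"
  proof (rule Residue_theorem[OF S(1)])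
    show "connected S" using S by (simp add: convex_connected)
    show "?g holomorphic_on S - ?P ` {-int m..int m}"
      using poles by (intro holomorphic_intros holomorphic_on_subset[OF FS]) auto
    have "path_image ?R \<subseteq> S"
      using a \<delta> by (intro order_trans[OF path_image_rectpath_subset_cbox RS]) auto
    moreover have "path_image ?R \<inter> box (Complex (-a) (-\<delta>)) (Complex a \<delta>) = {}"
      using a \<delta> by (intro path_image_rectpath_inter_box) auto
    ultimately show "path_image ?R \<subseteq> S - ?P ` {-int m..int m}"
      using kbox by blast
    show "\<forall>z. z \<notin> S \<longrightarrow> winding_number ?R z = 0"
      using a \<delta> RS by (auto intro!: winding_number_rectpath_outside)
  qed auto
  also have "\<dots> = 2 * pi * \<i> * (\<Sum>k\<in>{-int m..int m}. winding_number ?R (?P k) * residue ?g (?P k))"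
    by (subst sum.reindex[OF inj]) (simp add: o_def)
  also have "\<dots> = 2 * pi * \<i> * (\<Sum>k\<in>{-int m..int m}. F (?P k) * (of_real h / (2 * of_real pi * \<i>)))"
  proof (rule arg_cong[OF sum.cong[OF refl]])
    fix k assume k: "k \<in> {-int m..int m}"
    then have "?P k \<in> S" using kbox RS box_subset_cbox by blast
    then have "residue ?g (?P k) = F (?P k) * (of_real h / (2 * of_real pi * \<i>))"
      using h S FS by (intro residue_divide_exp_two_pi_i_minus_1) auto
    with winding_number_rectpath[OF kbox[OF k]]
    show "winding_number ?R (?P k) * residue ?g (?P k) = F (?P k) * (of_real h / (2 * of_real pi * \<i>))"
      by simp
  qed
  also have "\<dots> = of_real h * (\<Sum>k\<in>{-int m..int m}. F (?P k))"
    by (simp add: sum_distrib_left sum_distrib_right mult_ac)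
  finally show ?thesis .
qed

text \<open>The residue theorem writes the sum through integrals of \<open>g\<close> over the sides
  of the rectangle, and Cauchy's theorem moves the integral of \<open>F\<close> to height
  \<open>\<delta>\<close>. In the difference the upper line carries \<open>F + g\<close> and the
  lower line \<open>g\<close>, each at most \<open>B / (q - 1)\<close>. Each end contributes
  vertical segments of length \<open>\<delta>\<close> (from Cauchy) and \<open>2 * \<delta>\<close>
  (from the residue theorem), hence \<open>3 * \<delta>\<close>.\<close>

lemma trapezoidal_error_strip:
  fixes h \<delta> d :: real and m :: nat and B :: "real \<Rightarrow> real"
  assumes h: "0 < h" and \<delta>: "0 < \<delta>" "\<delta> < d" and F: "F holomorphic_on strip d"
    and bound: "\<And>x y. \<bar>y\<bar> \<le> \<delta> \<Longrightarrow> cmod (F (Complex x y)) \<le> B x"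
    and contB: "continuous_on UNIV B"
  defines "a \<equiv> (real m + 1/2) * h"
  shows "cmod (integral {-a..a} (\<lambda>x. F (of_real x)) - of_real h * (\<Sum>k\<in>{-int m..int m}. F (of_real (of_int k * h))))
    \<le> 2 / (exp (2 * pi * \<delta> / h) - 1) * integral {-a..a} B + 3 * \<delta> * (B a + B (-a))"
proof -
  define E where "E = (\<lambda>z. exp (2 * of_real pi * \<i> * z / complex_of_real h))"
  define g where "g = (\<lambda>z. F z / (E z - 1))"
  define q where "q = exp (2 * pi * \<delta> / h)"
  have q1: "q > 1" using h \<delta> by (simp add: q_def)
  have a: "0 < a" using h by (simp add: a_def)
  have B0: "0 \<le> B x" for x
    using order_trans[OF norm_ge_zero bound[of 0 x]] \<delta> by simp
  have Fcont: "continuous_on (strip d) F" using F by (rule holomorphic_on_imp_continuous_on)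
  have normE: "cmod (E (Complex x y)) = exp (- (2 * pi * y / h))" for x y
    by (simp add: E_def field_simps)
  have nz: "E (Complex x y) \<noteq> 1" if "y \<noteq> 0" for x y
    using normE[of x y] that h by auto
  \<comment> \<open>At abscissae \<open>\<plusminus> a\<close> the phase is an odd multiple of pi,
    so \<open>E z\<close> is a negative real number and \<open>E z - 1\<close> lies to the left of
    -1.\<close>
  have vert: "1 \<le> cmod (E z - 1)" if "\<bar>Re z\<bar> = a" for z
  proof -
    have "2 * pi * a / h = real (2 * m + 1) * pi"
      using h by (simp add: a_def field_simps)
    then have "cos (2 * pi * a / h) = -1"
      by (simp only: cos_npi) simp
    moreover have "Re z = a \<or> Re z = -a" using that by linarith
    ultimately have c: "cos (2 * pi * Re z / h) = -1" by auto
    have "Re (E z) = exp (- (2 * pi * Im z / h)) * cos (2 * pi * Re z / h)"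
      by (simp add: E_def Re_exp)
    then have "Re (E z - 1) = - exp (- (2 * pi * Im z / h)) - 1"
      using c by simp
    then show ?thesis
      using abs_Re_le_cmod[of "E z - 1"] exp_ge_zero[of "- (2 * pi * Im z / h)"] by linarith
  qed
  have Econt: "continuous_on A E" for A
    unfolding E_def using h by (intro continuous_intros) auto
  have gcont: "continuous_on A g" if "A \<subseteq> strip d" "\<And>z. z \<in> A \<Longrightarrow> E z \<noteq> 1" for A
    unfolding g_def using that by (intro continuous_intros Econt continuous_on_subset[OF Fcont]) auto
  have line: "continuous_on S (\<lambda>x. Complex x y)" for S y
    unfolding Complex_eq by (intro continuous_intros)
  have Fi: "(\<lambda>x. F (Complex x y)) integrable_on {-a..a}" if "\<bar>y\<bar> \<le> \<delta>" for y
    using that \<delta> by (intro integrable_continuous_real continuous_on_compose2[OF Fcont line]) (auto simp: strip_def)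
  have gi: "(\<lambda>x. g (Complex x y)) integrable_on {-a..a}" if "\<bar>y\<bar> = \<delta>" for y
  proof -
    have "continuous_on (range (\<lambda>x. Complex x y)) g"
      using that \<delta> nz[of y] by (intro gcont) (auto simp: strip_def)
    then show ?thesis
      by (intro integrable_continuous_real continuous_on_compose2[OF _ line]) auto
  qed
  have Bi: "(\<lambda>x. B x / (q - 1)) integrable_on {-a..a}"
    using contB q1 by (intro integrable_continuous_real continuous_intros) (auto intro: continuous_on_subset)

  have res: "of_real h * (\<Sum>k\<in>{-int m..int m}. F (of_real (of_int k * h))) =
      integral {-a..a} (\<lambda>x. g (Complex x (-\<delta>))) + contour_integral (linepath (Complex a (-\<delta>)) (Complex a \<delta>)) g
    - integral {-a..a} (\<lambda>x. g (Complex x \<delta>)) - contour_integral (linepath (Complex (-a) (-\<delta>)) (Complex (-a) \<delta>)) g"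
  proof -
    have "continuous_on (path_image (rectpath (Complex (-a) (-\<delta>)) (Complex a \<delta>))) g"
    proof (rule gcont)
      show "path_image (rectpath (Complex (-a) (-\<delta>)) (Complex a \<delta>)) \<subseteq> strip d"
        using a \<delta> by (auto simp: path_image_rectpath strip_def)
      fix z assume "z \<in> path_image (rectpath (Complex (-a) (-\<delta>)) (Complex a \<delta>))"
      then have "\<bar>Re z\<bar> = a \<or> Im z \<noteq> 0"
        using a \<delta> by (auto simp: path_image_rectpath)
      then show "E z \<noteq> 1"
        using vert[of z] nz[of "Im z" "Re z"] by auto
    qed
    then have "contour_integral (rectpath (Complex (-a) (-\<delta>)) (Complex a \<delta>)) g =
        integral {-a..a} (\<lambda>x. g (Complex x (-\<delta>))) + contour_integral (linepath (Complex a (-\<delta>)) (Complex a \<delta>)) g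
      - integral {-a..a} (\<lambda>x. g (Complex x \<delta>)) - contour_integral (linepath (Complex (-a) (-\<delta>)) (Complex (-a) \<delta>)) g"
      using a \<delta> by (intro contour_integral_rectpath_eq) auto
    with contour_integral_rectpath_eq_trapezoidal_sum[OF h \<delta> F, of m] show ?thesis
      by (simp only: a_def E_def g_def)
  qed
  \<comment> \<open>Only the upper half is used. On the lower line \<open>E\<close> is large and
    \<open>g\<close> is already small; on the upper line \<open>E\<close> is small and
    \<open>g\<close> is close to \<open>- F\<close>, so \<open>F\<close> has to be brought there to
    cancel it.\<close>
  have cauchy: "0 = integral {-a..a} (\<lambda>x. F (Complex x 0)) + contour_integral (linepath (Complex a 0) (Complex a \<delta>)) F
    - integral {-a..a} (\<lambda>x. F (Complex x \<delta>)) - contour_integral (linepath (Complex (-a) 0) (Complex (-a) \<delta>)) F"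
  proof -
    have sub: "path_image (rectpath (Complex (-a) 0) (Complex a \<delta>)) \<subseteq> strip d"
      using a \<delta> by (auto simp: path_image_rectpath strip_def)
    have "(F has_contour_integral 0) (rectpath (Complex (-a) 0) (Complex a \<delta>))"
      by (rule Cauchy_theorem_convex_simple[OF F convex_strip _ sub]) auto
    then have "contour_integral (rectpath (Complex (-a) 0) (Complex a \<delta>)) F = 0"
      by (rule contour_integral_unique)
    then show ?thesis
      using a \<delta> continuous_on_subset[OF Fcont sub] by (subst (asm) contour_integral_rectpath_eq) auto
  qed

  \<comment> \<open>Bounds on the vertical sides\<close>
  have seg: "z \<in> closed_segment (Complex b u) (Complex b v) \<Longrightarrow> Re z = b \<and> Im z \<in> {u..v}" if "u \<le> v" for z b u v
    using that by (auto simp: closed_segment_same_Re closed_segment_eq_real_ivl)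
  have segs: "closed_segment (Complex b u) (Complex b v) \<subseteq> strip d" if "u \<le> v" "-\<delta> \<le> u" "v \<le> \<delta>" for b u v
    using seg[OF that(1)] that \<delta> by (fastforce simp: strip_def)
  have FB: "cmod (F z) \<le> B b" if "Re z = b" "\<bar>Im z\<bar> \<le> \<delta>" for z b
    using bound[of "Im z" "Re z"] that by (cases z) simp
  have V2: "cmod (contour_integral (linepath (Complex b 0) (Complex b \<delta>)) F) \<le> B b * \<delta>" for b
  proof -
    have "cmod (contour_integral (linepath (Complex b 0) (Complex b \<delta>)) F)
      \<le> B b * norm (Complex b \<delta> - Complex b 0)"
    proof (rule contour_integral_bound_linepath)
      show "F contour_integrable_on linepath (Complex b 0) (Complex b \<delta>)"
        using segs[of 0 \<delta> b] \<delta> by (intro contour_integrable_continuous_linepath continuous_on_subset[OF Fcont]) auto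
      show "cmod (F z) \<le> B b" if "z \<in> closed_segment (Complex b 0) (Complex b \<delta>)" for z
        using seg[OF _ that] \<delta> by (intro FB) auto
    qed (rule B0)
    then show ?thesis using \<delta> by (simp add: complex_diff cmod_def)
  qed
  have V1: "cmod (contour_integral (linepath (Complex b (-\<delta>)) (Complex b \<delta>)) g) \<le> B b * (2 * \<delta>)" if b: "\<bar>b\<bar> = a" for b
  proof -
    have "cmod (contour_integral (linepath (Complex b (-\<delta>)) (Complex b \<delta>)) g)
      \<le> B b * norm (Complex b \<delta> - Complex b (-\<delta>))"
    proof (rule contour_integral_bound_linepath)
      show "g contour_integrable_on linepath (Complex b (-\<delta>)) (Complex b \<delta>)"
      proof (intro contour_integrable_continuous_linepath gcont)
        show "closed_segment (Complex b (-\<delta>)) (Complex b \<delta>) \<subseteq> strip d" using segs[of "-\<delta>" \<delta> b] \<delta> by auto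
        show "E z \<noteq> 1" if "z \<in> closed_segment (Complex b (-\<delta>)) (Complex b \<delta>)" for z
          using seg[OF _ that] \<delta> b vert[of z] by auto
      qed
      show "cmod (g z) \<le> B b" if "z \<in> closed_segment (Complex b (-\<delta>)) (Complex b \<delta>)" for z
      proof -
        have z: "Re z = b" "\<bar>Im z\<bar> \<le> \<delta>" using seg[OF _ that] \<delta> by auto
        have "cmod (g z) \<le> cmod (F z) / 1"
          unfolding g_def norm_divide using vert[of z] z b by (intro divide_left_mono) auto
        then show ?thesis using FB[OF z] by simp
      qed
    qed (rule B0)
    moreover have "norm (Complex b \<delta> - Complex b (-\<delta>)) = 2 * \<delta>"
      using \<delta> by (subst cmod_eq_Im) auto
    ultimately show ?thesis by simp
  qed

  \<comment> \<open>Bounds on the horizontal lines\<close>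
  have H1: "cmod (integral {-a..a} (\<lambda>x. g (Complex x (-\<delta>)))) \<le> integral {-a..a} (\<lambda>x. B x / (q - 1))"
  proof (rule integral_norm_bound_integral[OF gi Bi])
    fix x
    have "q - 1 \<le> cmod (E (Complex x (-\<delta>)) - 1)"
      using norm_triangle_ineq2[of "E (Complex x (-\<delta>))" 1] by (simp add: normE q_def)
    then show "cmod (g (Complex x (-\<delta>))) \<le> B x / (q - 1)"
      unfolding g_def norm_divide using q1 \<delta> B0 by (intro frac_le bound) auto
  qed (use \<delta> in auto)
  \<comment> \<open>Here \<open>F + g = F * E / (E - 1)\<close> with \<open>cmod E = 1 / q\<close>,
    which gives the same majorant as on the lower line.\<close>
  have H2: "cmod (integral {-a..a} (\<lambda>x. F (Complex x \<delta>) + g (Complex x \<delta>))) \<le> integral {-a..a} (\<lambda>x. B x / (q - 1))"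
  proof (rule integral_norm_bound_integral[OF _ Bi])
    show "(\<lambda>x. F (Complex x \<delta>) + g (Complex x \<delta>)) integrable_on {-a..a}"
      using \<delta> by (intro integrable_add Fi gi) auto
    fix x
    have Eq: "cmod (E (Complex x \<delta>)) = 1 / q"
      by (simp add: normE q_def exp_minus inverse_eq_divide)
    have "1 - 1 / q \<le> cmod (E (Complex x \<delta>) - 1)"
      using norm_triangle_ineq2[of 1 "E (Complex x \<delta>)"] by (simp add: Eq norm_minus_commute)
    moreover have "1 / q < 1" using q1 by simp
    ultimately have "cmod (F (Complex x \<delta>) * E (Complex x \<delta>) / (E (Complex x \<delta>) - 1)) \<le> B x * (1 / q) / (1 - 1 / q)"
      unfolding norm_divide norm_mult Eq using q1 \<delta> B0 by (intro frac_le mult_right_mono bound) auto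
    also have "\<dots> = B x / (q - 1)"
      using q1 by (simp add: field_simps)
    also have "F (Complex x \<delta>) * E (Complex x \<delta>) / (E (Complex x \<delta>) - 1) = F (Complex x \<delta>) + g (Complex x \<delta>)"
      using nz[of \<delta> x] \<delta> by (simp add: g_def field_simps)
    finally show "cmod (F (Complex x \<delta>) + g (Complex x \<delta>)) \<le> B x / (q - 1)" .
  qed

  have eq: "integral {-a..a} (\<lambda>x. F (of_real x)) - of_real h * (\<Sum>k\<in>{-int m..int m}. F (of_real (of_int k * h))) =
      integral {-a..a} (\<lambda>x. F (Complex x \<delta>) + g (Complex x \<delta>)) - integral {-a..a} (\<lambda>x. g (Complex x (-\<delta>)))
    + (contour_integral (linepath (Complex (-a) 0) (Complex (-a) \<delta>)) F - contour_integral (linepath (Complex a 0) (Complex a \<delta>)) F)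
    + (contour_integral (linepath (Complex (-a) (-\<delta>)) (Complex (-a) \<delta>)) g - contour_integral (linepath (Complex a (-\<delta>)) (Complex a \<delta>)) g)"
  proof -
    have F0: "integral {-a..a} (\<lambda>x. F (of_real x)) = integral {-a..a} (\<lambda>x. F (Complex x 0))"
      by (simp only: complex_of_real_def)
    have F1: "integral {-a..a} (\<lambda>x. F (Complex x 0)) = integral {-a..a} (\<lambda>x. F (Complex x \<delta>))
        + contour_integral (linepath (Complex (-a) 0) (Complex (-a) \<delta>)) F
        - contour_integral (linepath (Complex a 0) (Complex a \<delta>)) F"
      using cauchy by (simp add: algebra_simps)
    have F2: "integral {-a..a} (\<lambda>x. F (Complex x \<delta>) + g (Complex x \<delta>)) =
        integral {-a..a} (\<lambda>x. F (Complex x \<delta>)) + integral {-a..a} (\<lambda>x. g (Complex x \<delta>))"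
      using \<delta> by (intro integral_add Fi gi) auto
    show ?thesis
      unfolding res F0 F1 F2 by simp
  qed
  have "cmod (integral {-a..a} (\<lambda>x. F (Complex x \<delta>) + g (Complex x \<delta>)) - integral {-a..a} (\<lambda>x. g (Complex x (-\<delta>)))
    + (contour_integral (linepath (Complex (-a) 0) (Complex (-a) \<delta>)) F - contour_integral (linepath (Complex a 0) (Complex a \<delta>)) F)
    + (contour_integral (linepath (Complex (-a) (-\<delta>)) (Complex (-a) \<delta>)) g - contour_integral (linepath (Complex a (-\<delta>)) (Complex a \<delta>)) g))
    \<le> integral {-a..a} (\<lambda>x. B x / (q - 1)) + integral {-a..a} (\<lambda>x. B x / (q - 1))
      + (B (-a) * \<delta> + B a * \<delta>) + (B (-a) * (2 * \<delta>) + B a * (2 * \<delta>))"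
  proof -
    have "cmod (A1 - A2 + (A3 - A4) + (A5 - A6))
        \<le> cmod A1 + cmod A2 + (cmod A3 + cmod A4) + (cmod A5 + cmod A6)" for A1 A2 A3 A4 A5 A6
      using norm_triangle_ineq[of "A1 - A2 + (A3 - A4)" "A5 - A6"] norm_triangle_ineq[of "A1 - A2" "A3 - A4"]
        norm_triangle_ineq4[of A1 A2] norm_triangle_ineq4[of A3 A4] norm_triangle_ineq4[of A5 A6]
      by linarith
    then show ?thesis
      by (rule order_trans) (use a in \<open>intro add_mono H1 H2 V1 V2; simp\<close>)
  qed
  also have "\<dots> = 2 / (q - 1) * integral {-a..a} B + 3 * \<delta> * (B a + B (-a))"
  proof -
    have "x * i + x * i + (u * w + v * w) + (u * (2 * w) + v * (2 * w)) = 2 * i * x + 3 * w * (v + u)"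
      for x i u v w :: real by (simp add: algebra_simps)
    then show ?thesis by (simp only: divide_inverse integral_mult_left)
  qed
  finally show ?thesis unfolding eq q_def .
qed

section \<open>Tails of double exponential sums\<close>

lemma exp_ge_cubic:
  fixes y :: real
  assumes "0 \<le> y"
  shows "1 + y + y^2/2 + y^3/6 \<le> exp y"
proof -
  obtain t where "exp y = (\<Sum>m<4. y ^ m / fact m) + exp t / fact 4 * y ^ 4"
    using Maclaurin_exp_le[of y 4] by blast
  moreover have "(\<Sum>m<4. y ^ m / fact m) = 1 + y + y^2/2 + y^3/6"
    by (simp add: eval_nat_numeral fact_numeral)
  moreover have "0 \<le> exp t / fact 4 * y ^ 4" using assms by simp
  ultimately show ?thesis by linarith
qed

text \<open>
  The constant \<open>9/8\<close> replaces the factor 1 that monotonicity would give; it is absorbed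
  by the slack in the exponent, see \<open>exp_sinh_le_exp_div_ln\<close>.
\<close>

lemma exp_sinh_term_le_telescoping:
  fixes \<kappa> h t :: real
  assumes h: "0 < h" and \<kappa>: "0 < \<kappa>" and t: "1/2 \<le> \<kappa> * sinh t"
  shows "\<kappa> * h * cosh (t + h) * exp (-\<kappa> * sinh (t + h))
    \<le> 9/8 * (exp (-\<kappa> * sinh t) - exp (-\<kappa> * sinh (t + h)))"
proof -
  \<comment> \<open>\<open>y\<close> is the growth of the exponent over one step, and
    \<open>u\<close> is a lower bound for it in terms of \<open>q\<close>, obtained from
    \<open>\<kappa> * sinh t \<ge> 1/2\<close>. The factor
    \<open>\<kappa> * h * cosh (t + h)\<close> will be at most \<open>q * y\<close>, so the claim
    reduces to \<open>q * y \<le> 9/8 * (exp y - 1)\<close>.\<close>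
  define y where "y = \<kappa> * (sinh (t + h) - sinh t)"
  define q where "q = exp (h/2)"
  define u where "u = (q\<^sup>2 - 1) / 2"
  have q: "1 < q" using h by (simp add: q_def)
  have u: "0 < u" using q by (simp add: u_def one_less_power)
  have sq: "2 * sinh (h/2) * q = q\<^sup>2 - 1"
    by (simp add: sinh_field_def q_def exp_minus power2_eq_square field_simps)
  have ch: "sinh (h/2) + cosh (h/2) = q" unfolding q_def by (rule sinh_plus_cosh)
  have diff: "sinh (t + h) - sinh t = 2 * cosh (t + h/2) * sinh (h/2)"
    using sinh_add[of "t + h/2" "h/2"] sinh_diff[of "t + h/2" "h/2"] by (simp add: add_ac)
  have "sinh t * q \<le> cosh (t + h/2)"
  proof -
    have "sinh t * cosh (h/2) \<le> cosh t * cosh (h/2)"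
      by (intro mult_right_mono sinh_le_cosh_real) auto
    then show ?thesis
      by (simp add: cosh_add ch[symmetric] algebra_simps)
  qed
  then have "sinh t * q * (2 * sinh (h/2)) \<le> cosh (t + h/2) * (2 * sinh (h/2))"
    using h by (intro mult_right_mono) auto
  then have "sinh t * (q\<^sup>2 - 1) \<le> sinh (t + h) - sinh t"
    unfolding diff sq[symmetric] by (simp add: mult_ac)
  then have "\<kappa> * (sinh t * (q\<^sup>2 - 1)) \<le> y"
    unfolding y_def using \<kappa> by (intro mult_left_mono) auto
  moreover have "1/2 * (q\<^sup>2 - 1) \<le> (\<kappa> * sinh t) * (q\<^sup>2 - 1)"
    using t u by (intro mult_right_mono) (auto simp: u_def)
  ultimately have uy: "u \<le> y" unfolding u_def mult.assoc by simp
  then have y: "0 < y" using u by linarith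
  have "cosh (t + h) \<le> q * cosh (t + h/2)"
  proof -
    have "cosh (t + h) = cosh (t + h/2) * cosh (h/2) + sinh (t + h/2) * sinh (h/2)"
      using cosh_add[of "t + h/2" "h/2"] by (simp add: add_ac)
    also have "\<dots> \<le> cosh (t + h/2) * cosh (h/2) + cosh (t + h/2) * sinh (h/2)"
      using h by (intro add_left_mono mult_right_mono sinh_le_cosh_real) auto
    also have "\<dots> = q * cosh (t + h/2)" by (simp add: ch[symmetric] algebra_simps)
    finally show ?thesis .
  qed
  then have "\<kappa> * h * cosh (t + h) \<le> \<kappa> * h * (q * cosh (t + h/2))"
    using \<kappa> h by (intro mult_left_mono) auto
  also have "\<dots> \<le> \<kappa> * (2 * sinh (h/2)) * (q * cosh (t + h/2))"
    using \<kappa> h q le_sinh_real[of "h/2"] by (intro mult_right_mono mult_left_mono) auto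
  also have "\<dots> = q * y" by (simp add: y_def diff)
  also have "\<dots> \<le> 9/8 * (exp y - 1)"
  proof -
    \<comment> \<open>The inequality of arithmetic and geometric means around 6/5 makes the bound
      linear in \<open>u\<close>, because \<open>q^2 = 1 + 2 * u\<close>. What remains is a
      quadratic inequality in \<open>u\<close>; completing the square at 13/18 leaves a positive
      constant.\<close>
    have "q \<le> (q\<^sup>2 / (6/5) + 6/5) / 2"
      using zero_le_power2[of "q - 6/5"] by (simp add: power2_eq_square field_simps)
    also have "\<dots> = (5/6 * (1 + 2 * u) + 6/5) / 2" by (simp add: u_def field_simps)
    also have "\<dots> \<le> 9/8 * (1 + u/2 + u\<^sup>2/6)"
      using zero_le_power2[of "u - 13/18"] by (simp add: power2_eq_square field_simps)
    also have "\<dots> \<le> 9/8 * (1 + y/2 + y\<^sup>2/6)"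
      using uy u by (intro mult_left_mono add_mono divide_right_mono power_mono) auto
    finally have "q * y \<le> 9/8 * (1 + y/2 + y\<^sup>2/6) * y"
      using y by (intro mult_right_mono) auto
    also have "\<dots> = 9/8 * (y + y^2/2 + y^3/6)"
      by (simp add: power2_eq_square power3_eq_cube field_simps)
    also have "\<dots> \<le> 9/8 * (exp y - 1)"
      using exp_ge_cubic[of y] y by simp
    finally show ?thesis .
  qed
  finally have "\<kappa> * h * cosh (t + h) * exp (-\<kappa> * sinh (t + h)) \<le> 9/8 * (exp y - 1) * exp (-\<kappa> * sinh (t + h))"
    by (intro mult_right_mono) auto
  also have "\<dots> = 9/8 * (exp (y + -\<kappa> * sinh (t + h)) - exp (-\<kappa> * sinh (t + h)))"
    by (simp only: exp_add left_diff_distrib mult.assoc mult_1_left)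
  also have "y + -\<kappa> * sinh (t + h) = -\<kappa> * sinh t"
    by (simp add: y_def algebra_simps)
  finally show ?thesis .
qed

text \<open>The one-step bounds telescope; their hypothesis at \<open>N\<close> passes to all later
  points because sinh is increasing.\<close>

lemma exp_sinh_tail_sum_le:
  fixes \<kappa> h :: real and N m :: int
  assumes h: "0 < h" and \<kappa>: "0 < \<kappa>" and N: "1/2 \<le> \<kappa> * sinh (of_int N * h)" and m: "N \<le> m"
  shows "\<kappa> * h * (\<Sum>k\<in>{N+1..m}. cosh (of_int k * h) * exp (-\<kappa> * sinh (of_int k * h)))
    \<le> 9/8 * (exp (-\<kappa> * sinh (of_int N * h)) - exp (-\<kappa> * sinh (of_int m * h)))"
  using m
proof (induction m rule: int_ge_induct)
  case (step i)
  define E where "E = (\<lambda>k::int. exp (-\<kappa> * sinh (of_int k * h)))"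
  define T where "T = (\<lambda>k::int. cosh (of_int k * h) * E k)"
  have "sinh (of_int N * h) \<le> sinh (of_int i * h)" using step h by simp
  then have "1/2 \<le> \<kappa> * sinh (of_int i * h)"
    using N \<kappa> by (meson mult_left_mono order_less_imp_le order_trans)
  moreover have "of_int (i + 1) * h = of_int i * h + h" by (simp add: algebra_simps)
  ultimately have *: "\<kappa> * h * T (i + 1) \<le> 9/8 * (E i - E (i + 1))"
    using exp_sinh_term_le_telescoping[OF h \<kappa>] unfolding T_def E_def mult.assoc by metis
  have IH: "\<kappa> * h * sum T {N+1..i} \<le> 9/8 * (E N - E i)"
    using step.IH unfolding T_def E_def .
  have "{N+1..i+1} = insert (i+1) {N+1..i}" using step by auto
  then have "\<kappa> * h * sum T {N+1..i+1} = \<kappa> * h * sum T {N+1..i} + \<kappa> * h * T (i + 1)"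
    by (simp add: distrib_left)
  then have "\<kappa> * h * sum T {N+1..i+1} \<le> 9/8 * (E N - E (i + 1))"
    using * IH by simp
  then show ?case unfolding T_def E_def .
qed simp

text \<open>The tangent bound \<open>ln x \<le> x - 1\<close> at \<open>x = exp 1 / Y\<close> gives
  \<open>ln Y \<ge> 2 - exp 1 / Y\<close>; after clearing denominators the claim is just
  \<open>exp 1 \<le> Y\<close>. Equality holds at \<open>Y = exp 1\<close>.\<close>

lemma divide_ln_le:
  fixes Y :: real
  assumes "exp 1 \<le> Y"
  shows "Y / ln Y \<le> (Y + exp 1) / 2"
proof -
  have Y: "0 < Y" using assms exp_gt_zero[of "1::real"] by linarith
  have "ln (exp 1 / Y) \<le> exp 1 / Y - 1"
    using Y by (intro ln_le_minus_one) auto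
  then have l: "2 - exp 1 / Y \<le> ln Y" using Y by (simp add: ln_div)
  have "exp 1 / Y \<le> 1" using assms Y by simp
  then have l0: "0 < 2 - exp 1 / Y" by linarith
  have "Y / ln Y \<le> Y / (2 - exp 1 / Y)"
    using l l0 Y by (intro divide_left_mono mult_pos_pos) linarith+
  also have "\<dots> \<le> (Y + exp 1) / 2"
  proof -
    have "2 * Y * Y \<le> (Y + exp 1) * (2 * Y - exp 1)"
      using mult_left_mono[OF assms, of "exp 1"] by (simp add: algebra_simps)
    then have "2 * Y \<le> (Y + exp 1) * (2 - exp 1 / Y)" using Y by (simp add: field_simps)
    then show ?thesis using l0 by (simp add: pos_divide_le_eq)
  qed
  finally show ?thesis .
qed

text \<open>Applied with \<open>c = pi * \<gamma>\<close> and
  \<open>Y = 8 * d * n / \<gamma>\<close>, for which \<open>c * Y / 4 = 2 * pi * d * n\<close>: it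
  turns the decay at the cut-off \<open>x\<close> into the claimed rate. Since \<open>Y / L\<close>
  is at most about \<open>(exp x + exp 1) / 2\<close>, the exponent keeps a surplus of
  \<open>c/4 * (sinh x / 2) \<ge> 1/8\<close>, and \<open>exp (1/8) \<ge> 9/8\<close> absorbs the
  telescoping constant.\<close>

lemma exp_sinh_le_exp_div_ln:
  fixes c x Y L :: real
  assumes c: "0 < c" and cx: "1 \<le> c * sinh x" and Y: "exp 1 \<le> Y" "Y \<le> exp x" and L: "ln Y \<le> L"
  shows "9/8 * exp (- (c/2) * sinh x) \<le> exp (c/4) * exp (- (c * Y / 4) / L)"
proof -
  define Z where "Z = exp x"
  have e: "27/10 \<le> exp (1::real)" "exp (1::real) \<le> 272/100"
    using e_approx_32 by (simp_all add: abs_if split: if_splits)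
  have Z: "27/10 \<le> Z" "Y \<le> Z" using e Y by (auto simp: Z_def)
  have sh: "sinh x = (Z - 1/Z) / 2" by (simp add: sinh_field_def Z_def exp_minus inverse_eq_divide)
  have lnY: "1 \<le> ln Y" using Y exp_gt_zero[of "1::real"] by (subst ln_ge_iff) linarith+
  have "Y / L \<le> Y / ln Y"
    using L lnY Y exp_gt_zero[of "1::real"] by (intro divide_left_mono mult_pos_pos) linarith+
  also have "\<dots> \<le> (Z + 272/100) / 2" using divide_ln_le[OF Y(1)] e Z by simp
  finally have YL: "Y / L \<le> (Z + 272/100) / 2" .
  have "1 / Z \<le> 1 / (27/10)" using Z by (intro divide_left_mono) auto
  then have "sinh x / 2 \<le> 2 * sinh x + 1 - Y / L"
    unfolding sh using YL Z(1) by argo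
  then have "c / 4 * (sinh x / 2) \<le> c / 4 * (2 * sinh x + 1 - Y / L)"
    using c by (intro mult_left_mono) auto
  moreover have "1/8 + - (c/2) * s \<le> c/4 + - (c/4 * r)"
    if "c / 4 * (s / 2) \<le> c / 4 * (2 * s + 1 - r)" "1 \<le> c * s" for s r
    using that by (simp add: algebra_simps)
  ultimately have main: "1/8 + - (c/2) * sinh x \<le> c/4 + - (c/4 * (Y/L))"
    using cx by blast
  have "9/8 * exp (- (c/2) * sinh x) \<le> exp (1/8) * exp (- (c/2) * sinh x)"
    using exp_ge_add_one_self[of "1/8::real"] by (intro mult_right_mono) auto
  also have "\<dots> \<le> exp (c/4) * exp (- (c * Y / 4) / L)"
  proof -
    have "- (c/4 * (Y/L)) = - (c * Y / 4) / L" by simp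
    with main show ?thesis
      unfolding exp_add[symmetric] exp_le_cancel_iff by (simp only:)
  qed
  finally show ?thesis .
qed

text \<open>
  The function \<open>x \<mapsto> cosh x * exp (- pi * \<gamma> * sinh x)\<close> decreases only from
  \<open>sinh x = (1 + sqrt (1 - (2*pi*\<gamma>)^2)) / (2*pi*\<gamma>)\<close> on, which is larger than \<open>sinh (x_gamma \<gamma>)\<close>
  for small \<open>\<gamma>\<close>. The tail estimate therefore avoids monotonicity and uses just the inequality below.
\<close>

lemma x_gamma_le_imp:
  assumes \<gamma>: "0 < \<gamma>" and x: "x_gamma \<gamma> \<le> x"
  shows "1 \<le> 2 * pi * \<gamma> * sinh x"
proof (cases "\<gamma> < 1 / (2 * pi)")
  case True
  define r where "r = sqrt (1 - (2 * pi * \<gamma>)\<^sup>2)"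
  have c: "0 < 2 * pi * \<gamma>" "2 * pi * \<gamma> < 1" using \<gamma> True by (auto simp: field_simps)
  then have "0 \<le> r" by (simp add: r_def abs_square_le_1 abs_le_iff)
  then have "1 / (2 * pi * \<gamma>) \<le> sqrt (1 + r) / (2 * pi * \<gamma>)"
    using c by (intro divide_right_mono) auto
  also have "\<dots> = sinh (x_gamma \<gamma>)" using True \<gamma> by (simp add: x_gamma_def r_def)
  also have "\<dots> \<le> sinh x" using x by simp
  finally show ?thesis using c by (simp add: field_simps)
next
  case False
  then have c: "1 \<le> 2 * pi * \<gamma>" by (simp add: field_simps)
  have "1 = sinh (x_gamma \<gamma>)" using False by (simp add: x_gamma_def)
  also have "\<dots> \<le> sinh x" using x by simp
  finally show ?thesis using mult_mono[OF c, of 1 "sinh x"] c by simp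
qed

text \<open>Splitting at 0 removes the absolute value, and each half is an exact derivative of an
  exponential divided by \<open>\<kappa>\<close>.\<close>

lemma integral_cosh_exp_abs_sinh_le:
  fixes \<kappa> a :: real
  assumes \<kappa>: "0 < \<kappa>" and a: "0 \<le> a"
  shows "integral {-a..a} (\<lambda>x. cosh x * exp (-\<kappa> * \<bar>sinh x\<bar>)) \<le> 2 / \<kappa>"
proof -
  let ?f = "\<lambda>x. cosh x * exp (-\<kappa> * \<bar>sinh x\<bar>)"
  have "((\<lambda>x. cosh x * exp (-\<kappa> * sinh x)) has_integral
      (- exp (-\<kappa> * sinh a) / \<kappa> - (- exp (-\<kappa> * sinh 0) / \<kappa>))) {0..a}"
    using a \<kappa> by (intro fundamental_theorem_of_calculus)
      (auto intro!: derivative_eq_intros simp: has_real_derivative_iff_has_vector_derivative[symmetric])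
  then have R: "(?f has_integral (1 / \<kappa> - exp (-\<kappa> * sinh a) / \<kappa>)) {0..a}"
    by (rule has_integral_eq_rhs[OF has_integral_eq[rotated]]) auto
  have "((\<lambda>x. cosh x * exp (\<kappa> * sinh x)) has_integral
      (exp (\<kappa> * sinh 0) / \<kappa> - exp (\<kappa> * sinh (-a)) / \<kappa>)) {-a..0}"
    using a \<kappa> by (intro fundamental_theorem_of_calculus)
      (auto intro!: derivative_eq_intros simp: has_real_derivative_iff_has_vector_derivative[symmetric])
  then have L: "(?f has_integral (1 / \<kappa> - exp (-\<kappa> * sinh a) / \<kappa>)) {-a..0}"
    by (rule has_integral_eq_rhs[OF has_integral_eq[rotated]]) auto
  have "(?f has_integral (1 / \<kappa> - exp (-\<kappa> * sinh a) / \<kappa>) + (1 / \<kappa> - exp (-\<kappa> * sinh a) / \<kappa>)) {-a..a}"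
    using a by (intro has_integral_combine[OF _ _ L R]) auto
  then have "integral {-a..a} ?f = 2 * (1 / \<kappa> - exp (-\<kappa> * sinh a) / \<kappa>)"
    by (simp add: integral_unique)
  also have "\<dots> \<le> 2 / \<kappa>" using \<kappa> by simp
  finally show ?thesis .
qed

section \<open>The transformed integrand\<close>

text \<open>The integrand after \<open>t = psi z\<close>. The derivative of \<open>psi\<close> is
  written out because \<open>psi'\<close> takes real arguments only, while contour integration needs
  the whole strip.\<close>

definition de_integrand :: "(complex \<Rightarrow> complex) \<Rightarrow> complex \<Rightarrow> complex" where
  "de_integrand f z = f (psi z) * (of_real (pi/2) * cosh z * psi z)"

lemma holomorphic_on_psi: "psi holomorphic_on A"
  unfolding psi_def sinh_field_def by (intro holomorphic_intros) auto

lemma holomorphic_on_de_integrand: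
  assumes "f analytic_on (psi ` strip d)"
  shows "de_integrand f holomorphic_on strip d"
proof -
  have "(f \<circ> psi) holomorphic_on strip d"
    using analytic_imp_holomorphic[OF assms] holomorphic_on_psi by (rule holomorphic_on_compose[rotated])
  then show ?thesis
    unfolding de_integrand_def[abs_def] cosh_field_def o_def
    by (intro holomorphic_intros holomorphic_on_psi) auto
qed

lemma psi_of_real: "psi (of_real x) = of_real (exp (pi/2 * sinh x))"
  by (simp add: psi_def sinh_field_def flip: exp_of_real)

lemma de_integrand_of_real: "de_integrand f (of_real x) = f (psi (of_real x)) * of_real (psi' x)"
  unfolding de_integrand_def psi_of_real psi'_def
  by (simp add: cosh_field_def flip: exp_of_real)

text \<open>With \<open>w = psi z\<close> and \<open>cmod w = exp (a/2)\<close>, the denominator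
  satisfies \<open>cmod (1 + w^2) \<ge> C * (1 + exp a)\<close>. Keeping the summand
  \<open>exp a\<close> gives decay at the right end with rate \<beta>; keeping the summand 1 gives
  decay at the left end with rate \<alpha>.\<close>

lemma de_integrand_bound:
  fixes K \<alpha> \<beta> d \<delta> :: real
  assumes K: "0 < K" and \<alpha>: "0 < \<alpha>" and \<beta>: "0 < \<beta>" and d: "d < pi/2" "\<delta> < d"
    and bound: "\<And>z. z \<in> psi ` strip d \<Longrightarrow>
        cmod (f z) \<le> K * cmod (z powr (of_real (\<alpha> - 1)) / (1 + z^2) powr (of_real ((\<alpha> + \<beta>)/2)))"
    and z: "\<bar>Im z\<bar> \<le> \<delta>"
  defines "B \<equiv> K * (pi/2) / cos (pi/2 * sin \<delta>) powr ((\<alpha> + \<beta>)/2)"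
  shows "cmod (de_integrand f z) \<le> B * (cosh (Re z) * exp (- (pi/2 * \<beta>) * Re (sinh z)))"
    and "cmod (de_integrand f z) \<le> B * (cosh (Re z) * exp (pi/2 * \<alpha> * Re (sinh z)))"
proof -
  define s where "s = (\<alpha> + \<beta>) / 2"
  define w where "w = psi z"
  define a where "a = pi * Re (sinh z)"
  define C where "C = cos (pi/2 * sin \<delta>)"
  define D where "D = cmod (1 + w\<^sup>2)"
  have \<delta>: "0 \<le> \<delta>" "\<delta> < pi/2" using z d by auto
  have C: "0 < C" unfolding C_def using \<delta> by (intro cos_half_pi_sin_pos) auto
  have CC: "C \<le> cos (pi/2 * sin (Im z))"
  proof -
    have "\<bar>sin (Im z)\<bar> = sin \<bar>Im z\<bar>"
      using z \<delta> sin_ge_zero[of "Im z"] sin_ge_zero[of "- Im z"] by (auto simp: abs_if)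
    also have "\<dots> \<le> sin \<delta>" using z \<delta> by (intro sin_monotone_2pi_le) auto
    finally have "\<bar>pi/2 * sin (Im z)\<bar> \<le> pi/2 * sin \<delta>" by (simp add: abs_mult)
    moreover have "pi/2 * sin \<delta> \<le> pi"
      using mult_left_mono[OF sin_le_one[of \<delta>], of "pi/2"] pi_gt_zero by linarith
    ultimately have "cos (pi/2 * sin \<delta>) \<le> cos \<bar>pi/2 * sin (Im z)\<bar>"
      by (intro cos_monotone_0_pi_le) auto
    then show ?thesis by (simp only: C_def cos_abs_real)
  qed
  have w: "cmod w = exp (a/2)" by (simp add: w_def psi_def a_def)
  have w2: "w\<^sup>2 = exp (of_real pi * sinh z)"
    by (simp add: w_def psi_def power2_eq_square flip: exp_add distrib_right)
  have "C * (1 + exp a) \<le> D"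
  proof -
    have "C * (1 + exp a) \<le> (1 + exp a) * cos (pi/2 * sin (Im z))"
      using CC by (subst mult.commute) (intro mult_left_mono, auto simp: add_nonneg_nonneg)
    also have "\<dots> \<le> D"
      unfolding D_def w2 a_def using z \<delta> by (intro norm_one_add_exp_sinh_ge) auto
    finally show ?thesis .
  qed
  moreover have "C \<le> C * (1 + exp a)" "C * exp a \<le> C * (1 + exp a)"
    using C by auto
  ultimately have D: "C \<le> D" "C * exp a \<le> D" by linarith+
  have s: "0 \<le> s" using \<alpha> \<beta> by (simp add: s_def)
  have "w \<in> psi ` strip d" using z d by (auto simp: w_def strip_def)
  \<comment> \<open>The exponents are real, so the modulus of a principal power is the real power of
    the modulus and no argument enters.\<close>
  from bound[OF this] have "cmod (f w) \<le> K * (exp (a/2) powr (\<alpha> - 1) / D powr s)"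
    by (simp add: norm_divide norm_powr_real_powr' w D_def s_def)
  then have "cmod (de_integrand f z) \<le> K * (exp (a/2) powr (\<alpha> - 1) / D powr s) * (pi/2 * cosh (Re z) * exp (a/2))"
    unfolding de_integrand_def norm_mult w_def[symmetric] w
    using cmod_cosh_le[of z] K by (intro mult_mono) auto
  also have "\<dots> = K * (pi/2) * cosh (Re z) * (exp (a/2) powr (\<alpha> - 1) * exp (a/2)) / D powr s"
    by (simp add: mult_ac)
  also have "exp (a/2) powr (\<alpha> - 1) * exp (a/2) = exp (\<alpha> * a / 2)"
    by (simp add: powr_def algebra_simps diff_divide_distrib flip: exp_add)
  finally have F: "cmod (de_integrand f z) \<le> K * (pi/2) * cosh (Re z) * exp (\<alpha> * a / 2) / D powr s" .
  have "C powr s * exp (a * s) = (C * exp a) powr s"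
    using C by (simp add: powr_def ln_mult distrib_left exp_add mult_ac)
  also have "\<dots> \<le> D powr s" using C D s by (intro powr_mono2) auto
  finally have D1: "C powr s * exp (a * s) \<le> D powr s" .
  have D2: "C powr s \<le> D powr s" using C D s by (intro powr_mono2) auto
  have Dp: "0 < C powr s" "0 < D powr s" using C D by auto
  note F
  also have "K * (pi/2) * cosh (Re z) * exp (\<alpha> * a / 2) / D powr s
      \<le> K * (pi/2) * cosh (Re z) * exp (\<alpha> * a / 2) / (C powr s * exp (a * s))"
    using D1 Dp K by (intro divide_left_mono mult_pos_pos) auto
  also have "\<dots> = B * (cosh (Re z) * (exp (\<alpha> * a / 2) / exp (a * s)))"
    by (simp add: B_def C_def s_def)
  also have "exp (\<alpha> * a / 2) / exp (a * s) = exp (- (pi/2 * \<beta>) * Re (sinh z))"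
    unfolding exp_diff[symmetric] by (simp add: s_def a_def field_simps)
  finally show "cmod (de_integrand f z) \<le> B * (cosh (Re z) * exp (- (pi/2 * \<beta>) * Re (sinh z)))" .
  note F
  also have "K * (pi/2) * cosh (Re z) * exp (\<alpha> * a / 2) / D powr s
      \<le> K * (pi/2) * cosh (Re z) * exp (\<alpha> * a / 2) / C powr s"
    using D2 Dp K by (intro divide_left_mono mult_pos_pos) auto
  also have "\<dots> = B * (cosh (Re z) * exp (pi/2 * \<alpha> * Re (sinh z)))"
    by (simp add: B_def C_def s_def a_def field_simps)
  finally show "cmod (de_integrand f z) \<le> B * (cosh (Re z) * exp (pi/2 * \<alpha> * Re (sinh z)))" .
qed

text \<open>The sign of \<open>s\<close> decides which of the two exponentials decays; this merges
  the two one-sided bounds into one in \<open>\<bar>sinh x\<bar>\<close>.\<close>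

lemma exp_mult_le_exp_neg_min_abs:
  fixes p q m c s u :: real
  assumes "m \<le> p" "m \<le> q" "0 \<le> m" "0 \<le> c" "c \<le> u"
  shows "min (exp (- p * (s * u))) (exp (q * (s * u))) \<le> exp (- (m * c) * \<bar>s\<bar>)"
proof (cases "0 \<le> s")
  case True
  have "m * c * s \<le> p * u * s" using assms True by (intro mult_right_mono mult_mono) auto
  then show ?thesis using True by (simp add: min_le_iff_disj mult_ac)
next
  case False
  have "m * c * (-s) \<le> q * u * (-s)" using assms False by (intro mult_right_mono mult_mono) auto
  then show ?thesis using False by (simp add: min_le_iff_disj mult_ac)
qed

lemma de_integrand_bound_uniform:
  fixes K \<alpha> \<beta> d \<delta> :: real
  assumes K: "0 < K" and \<alpha>: "0 < \<alpha>" and \<beta>: "0 < \<beta>" and d: "d < pi/2" "\<delta> < d"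
    and bound: "\<And>z. z \<in> psi ` strip d \<Longrightarrow>
        cmod (f z) \<le> K * cmod (z powr (of_real (\<alpha> - 1)) / (1 + z^2) powr (of_real ((\<alpha> + \<beta>)/2)))"
    and y: "\<bar>y\<bar> \<le> \<delta>"
  shows "cmod (de_integrand f (Complex x y)) \<le> K * (pi/2) / cos (pi/2 * sin \<delta>) powr ((\<alpha> + \<beta>)/2)
     * (cosh x * exp (- (pi/2 * min \<alpha> \<beta> * cos \<delta>) * \<bar>sinh x\<bar>))"
proof -
  define B where "B = K * (pi/2) / cos (pi/2 * sin \<delta>) powr ((\<alpha> + \<beta>)/2)"
  have \<delta>: "0 \<le> \<delta>" "\<delta> < pi/2" using y d by auto
  have B: "0 \<le> B" using K by (simp add: B_def)
  have cy: "cos \<delta> \<le> cos y"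
    using cos_monotone_0_pi_le[of "\<bar>y\<bar>" \<delta>] y \<delta> by simp
  have c0: "0 \<le> cos \<delta>" using \<delta> by (intro cos_ge_zero) auto
  have "cmod (de_integrand f (Complex x y))
      \<le> B * (cosh x * min (exp (- (pi/2 * \<beta>) * (sinh x * cos y))) (exp (pi/2 * \<alpha> * (sinh x * cos y))))"
    using de_integrand_bound[OF K \<alpha> \<beta> d bound, of "Complex x y"] y
    by (simp add: B_def Re_sinh min_def)
  also have "\<dots> \<le> B * (cosh x * exp (- (pi/2 * min \<alpha> \<beta> * cos \<delta>) * \<bar>sinh x\<bar>))"
    using \<alpha> \<beta> cy c0 by (intro mult_left_mono[OF _ B] mult_left_mono exp_mult_le_exp_neg_min_abs) auto
  finally show ?thesis by (simp only: B_def)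
qed

section \<open>Limits over expanding intervals\<close>

lemma tendsto_cosh_exp_abs_sinh:
  fixes \<kappa> :: real
  assumes "0 < \<kappa>"
  shows "((\<lambda>x. cosh x * exp (- \<kappa> * \<bar>sinh x\<bar>)) \<longlongrightarrow> 0) at_top"
proof -
  have "((\<lambda>x. cosh x * exp (- \<kappa> * sinh x)) \<longlongrightarrow> 0) at_top"
    unfolding sinh_field_def cosh_field_def using assms by real_asymp
  then show ?thesis
    by (rule Lim_transform_eventually) (auto intro: eventually_mono[OF eventually_ge_at_top[of 0]])
qed

text \<open>Substitution is available on compact intervals, whose images exhaust the half-line. The
  bound \<open>C\<close> and monotone convergence first make \<open>norm (f t)\<close> integrable;
  it then serves as the majorant for dominated convergence of the integrals of
  \<open>f\<close>.\<close>

lemma tendsto_integral_substitution_exhaustion: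
  fixes f :: "real \<Rightarrow> complex" and \<phi> \<phi>' :: "real \<Rightarrow> real" and b :: "nat \<Rightarrow> real"
  assumes f: "continuous_on {0<..} f"
    and \<phi>: "\<And>x. (\<phi> has_real_derivative \<phi>' x) (at x)" "\<And>x. 0 \<le> \<phi>' x" "range \<phi> = {0<..}"
    and b: "mono b" "filterlim b at_top sequentially" "\<And>m. 0 \<le> b m"
    and C: "\<And>m. integral {- b m..b m} (\<lambda>x. norm (\<phi>' x *\<^sub>R f (\<phi> x))) \<le> C"
  shows "(\<lambda>m. integral {- b m..b m} (\<lambda>x. \<phi>' x *\<^sub>R f (\<phi> x))) \<longlonglongrightarrow> integral {0<..} f"
proof -
  have mono: "\<phi> x \<le> \<phi> y" if "x \<le> y" for x y
    using \<phi> by (intro DERIV_nonneg_imp_nondecreasing[OF that]) blast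
  have pos: "0 < \<phi> x" for x using \<phi>(3) by auto
  define I where "I = (\<lambda>m. {\<phi> (- b m)..\<phi> (b m)})"
  have I: "I m \<subseteq> {0<..}" for m using less_le_trans[OF pos] by (auto simp: I_def)
  have Imono: "I m \<subseteq> I (Suc m)" for m
    using monoD[OF b(1), of m "Suc m"] mono[of "- b (Suc m)" "- b m"] mono[of "b m" "b (Suc m)"]
    by (auto simp: I_def)
  have ev: "\<forall>\<^sub>F m in sequentially. t \<in> I m" if "t \<in> {0<..}" for t
  proof -
    from that have "t \<in> range \<phi>" using \<phi>(3) by simp
    then obtain x where x: "t = \<phi> x" by blast
    have "\<forall>\<^sub>F m in sequentially. \<bar>x\<bar> \<le> b m"
      using b(2) by (simp add: filterlim_at_top)
    then show ?thesis
      by (rule eventually_mono) (auto simp: x I_def intro!: mono)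
  qed
  have sub: "((\<lambda>x. \<phi>' x *\<^sub>R g (\<phi> x)) has_integral integral (I m) g) {- b m..b m}"
    if "continuous_on {0<..} g" for g :: "real \<Rightarrow> 'a::euclidean_space" and m
    unfolding I_def
  proof (rule has_integral_substitution)
    show "continuous_on {\<phi> (- b m)..\<phi> (b m)} g"
      using continuous_on_subset[OF that I[of m]] by (simp add: I_def)
    show "(\<phi> has_real_derivative \<phi>' x) (at x within {- b m..b m})" for x
      using \<phi>(1) by (rule has_field_derivative_at_within)
  qed (use b(3)[of m] mono in auto)
  have intI: "((\<lambda>t. if t \<in> I m then g t else 0) has_integral integral (I m) g) {0<..}"
    if "continuous_on {0<..} g" for g :: "real \<Rightarrow> 'a::euclidean_space" and m
  proof -
    have "g integrable_on I m" unfolding I_def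
      using continuous_on_subset[OF that I[of m]] by (intro integrable_continuous_real) (simp add: I_def)
    then show ?thesis using I by (simp add: has_integral_integral)
  qed
  have nf: "continuous_on {0<..} (\<lambda>t. norm (f t))" using f by (intro continuous_intros)
  have "(\<lambda>t. norm (f t)) integrable_on {0<..} \<and>
    (\<lambda>m. integral {0<..} (\<lambda>t. if t \<in> I m then norm (f t) else 0)) \<longlonglongrightarrow> integral {0<..} (\<lambda>t. norm (f t))"
  proof (rule monotone_convergence_increasing)
    show "(\<lambda>t. if t \<in> I m then norm (f t) else 0) integrable_on {0<..}" for m
      using intI[OF nf] by blast
    show "(if t \<in> I m then norm (f t) else 0) \<le> (if t \<in> I (Suc m) then norm (f t) else 0)" for m t
      using Imono[of m] by auto
    show "(\<lambda>m. if t \<in> I m then norm (f t) else 0) \<longlonglongrightarrow> norm (f t)" if "t \<in> {0<..}" for t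
      by (rule tendsto_eventually, rule eventually_mono[OF ev[OF that]]) simp
    show "bounded (range (\<lambda>m. integral {0<..} (\<lambda>t. if t \<in> I m then norm (f t) else 0)))"
    proof (rule boundedI)
      fix v assume "v \<in> range (\<lambda>m. integral {0<..} (\<lambda>t. if t \<in> I m then norm (f t) else 0))"
      then obtain m where v: "v = integral (I m) (\<lambda>t. norm (f t))"
        using intI[OF nf] by (auto dest: integral_unique)
      have "v = integral {- b m..b m} (\<lambda>x. \<phi>' x *\<^sub>R norm (f (\<phi> x)))"
        unfolding v using sub[OF nf, of m] by (simp add: integral_unique)
      then have "v \<le> C" using C[of m] \<phi>(2) by simp
      moreover have "0 \<le> v" unfolding v
        by (rule integral_nonneg) (use continuous_on_subset[OF nf I[of m]] in
            \<open>auto simp: I_def intro: integrable_continuous_real\<close>)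
      ultimately show "norm v \<le> C" by simp
    qed
  qed
  then have hi: "(\<lambda>t. norm (f t)) integrable_on {0<..}" ..
  have "(\<lambda>m. integral {0<..} (\<lambda>t. if t \<in> I m then f t else 0)) \<longlonglongrightarrow> integral {0<..} f"
  proof (rule dominated_convergence(2)[OF _ hi])
    show "(\<lambda>t. if t \<in> I m then f t else 0) integrable_on {0<..}" for m
      using intI[OF f] by blast
    show "(\<lambda>m. if t \<in> I m then f t else 0) \<longlonglongrightarrow> f t" if "t \<in> {0<..}" for t
      by (rule tendsto_eventually, rule eventually_mono[OF ev[OF that]]) simp
  qed auto
  moreover have "integral {0<..} (\<lambda>t. if t \<in> I m then f t else 0) = integral {- b m..b m} (\<lambda>x. \<phi>' x *\<^sub>R f (\<phi> x))" for m
    using intI[OF f, of m] sub[OF f, of m] by (simp add: integral_unique)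
  ultimately show ?thesis by simp
qed

section \<open>The quadrature error\<close>

text \<open>Both ends share this estimate, with \<open>\<gamma>\<close> equal to \<alpha> or
  \<beta>. The \<open>x_gamma\<close> hypothesis enters only as
  \<open>pi * \<gamma> * sinh (N * h) \<ge> 1\<close>, which is what telescoping and absorbing 9/8
  require.\<close>

lemma exp_sinh_tail_sum_bound:
  fixes h \<gamma> K Y L :: real and N m :: int and G :: "int \<Rightarrow> real"
  assumes h: "0 < h" and K: "0 < K" and \<gamma>: "0 < \<gamma>"
    and N: "x_gamma (\<gamma>/2) \<le> of_int N * h" and Y: "exp 1 \<le> Y" "Y \<le> exp (of_int N * h)"
    and L: "ln Y \<le> L" and m: "N \<le> m"
    and G: "\<And>k. G k \<le> K * (pi/2) * (cosh (of_int k * h) * exp (- (pi/2 * \<gamma>) * sinh (of_int k * h)))"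
  shows "h * sum G {N+1..m} \<le> K / \<gamma> * (exp (pi * \<gamma> / 4) * exp (- (pi * \<gamma> * Y / 4) / L))"
proof -
  define \<kappa> where "\<kappa> = pi/2 * \<gamma>"
  have \<kappa>: "0 < \<kappa>" using \<gamma> by (simp add: \<kappa>_def)
  have cx: "1 \<le> pi * \<gamma> * sinh (of_int N * h)"
    using x_gamma_le_imp[OF _ N] \<gamma> by simp
  define S where "S = (\<Sum>k\<in>{N+1..m}. cosh (of_int k * h) * exp (- \<kappa> * sinh (of_int k * h)))"
  have "h * sum G {N+1..m} \<le> h * (\<Sum>k\<in>{N+1..m}. K * (pi/2) * (cosh (of_int k * h) * exp (- \<kappa> * sinh (of_int k * h))))"
    using h G unfolding \<kappa>_def by (intro mult_left_mono sum_mono) auto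
  also have "\<dots> = K / \<gamma> * (\<kappa> * h * S)"
    using \<gamma> unfolding S_def sum_distrib_left[symmetric] by (simp add: \<kappa>_def)
  also have "\<dots> \<le> K / \<gamma> * (9/8 * exp (- \<kappa> * sinh (of_int N * h)))"
  proof (intro mult_left_mono)
    have "\<kappa> * h * S \<le> 9/8 * (exp (- \<kappa> * sinh (of_int N * h)) - exp (- \<kappa> * sinh (of_int m * h)))"
      unfolding S_def using cx by (intro exp_sinh_tail_sum_le[OF h \<kappa> _ m]) (simp add: \<kappa>_def)
    also have "\<dots> \<le> 9/8 * exp (- \<kappa> * sinh (of_int N * h))" by simp
    finally show "\<kappa> * h * S \<le> 9/8 * exp (- \<kappa> * sinh (of_int N * h))" .
  qed (use K \<gamma> in simp)
  also have "\<dots> \<le> K / \<gamma> * (exp (pi * \<gamma> / 4) * exp (- (pi * \<gamma> * Y / 4) / L))"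
  proof (intro mult_left_mono)
    have "\<kappa> = pi * \<gamma> / 2" by (simp add: \<kappa>_def)
    then show "9/8 * exp (- \<kappa> * sinh (of_int N * h)) \<le> exp (pi * \<gamma> / 4) * exp (- (pi * \<gamma> * Y / 4) / L)"
      using exp_sinh_le_exp_div_ln[OF _ cx Y L] \<gamma> by (simp only:) simp
  qed (use K \<gamma> in simp)
  finally show ?thesis .
qed

lemma range_exp_sinh: "range (\<lambda>x. exp (pi/2 * sinh x)) = {0<..}"
proof (intro set_eqI iffI)
  fix t :: real assume t: "t \<in> {0<..}"
  then have "t = exp (pi/2 * sinh (arsinh (2 / pi * ln t)))" by simp
  then show "t \<in> range (\<lambda>x. exp (pi/2 * sinh x))" by (rule range_eqI)
qed auto

lemma tendsto_integral_de_integrand: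
  fixes K \<alpha> \<beta> d h :: real
  assumes K: "0 < K" and \<alpha>: "0 < \<alpha>" and \<beta>: "0 < \<beta>" and d: "0 < d" "d < pi/2"
    and f: "f analytic_on (psi ` strip d)"
    and bound: "\<And>z. z \<in> psi ` strip d \<Longrightarrow>
        cmod (f z) \<le> K * cmod (z powr (of_real (\<alpha> - 1)) / (1 + z^2) powr (of_real ((\<alpha> + \<beta>)/2)))"
    and h: "0 < h"
  shows "(\<lambda>m. integral {- ((real m + 1/2) * h)..(real m + 1/2) * h} (\<lambda>x. de_integrand f (of_real x)))
    \<longlonglongrightarrow> integral {0<..} (\<lambda>t. f (of_real t))"
proof -
  define \<phi> where "\<phi> = (\<lambda>x::real. exp (pi/2 * sinh x))"
  define \<mu> where "\<mu> = min \<alpha> \<beta>"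
  have F: "de_integrand f (of_real x) = psi' x *\<^sub>R f (of_real (\<phi> x))" for x
    unfolding de_integrand_of_real psi_of_real \<phi>_def scaleR_conv_of_real by (rule mult.commute)
  let ?b = "\<lambda>m. (real m + 1/2) * h"
  have b0: "0 < ?b m" for m using h by simp
  have \<mu>: "0 < pi/2 * \<mu>" using \<alpha> \<beta> by (simp add: \<mu>_def)
  have real_in: "of_real x \<in> strip d" for x using d by (simp add: strip_def)
  have "(\<lambda>m. integral {- ?b m..?b m} (\<lambda>x. psi' x *\<^sub>R f (of_real (\<phi> x))))
    \<longlonglongrightarrow> integral {0<..} (\<lambda>t. f (of_real t))"
  proof (rule tendsto_integral_substitution_exhaustion[where \<phi> = \<phi> and \<phi>' = psi' and f = "\<lambda>t. f (of_real t)"])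
    have "continuous_on (psi ` strip d) f"
      using f by (intro holomorphic_on_imp_continuous_on analytic_imp_holomorphic)
    moreover have "of_real ` {0<..} \<subseteq> psi ` strip d"
      unfolding range_exp_sinh[symmetric]
      unfolding image_image psi_of_real[symmetric] using real_in by blast
    ultimately show "continuous_on {0<..} (\<lambda>t::real. f (of_real t))"
      by (intro continuous_on_compose2[where g = f and f = of_real]) (auto intro!: continuous_intros)
    show "(\<phi> has_real_derivative psi' x) (at x)" for x
      unfolding \<phi>_def psi'_def by (auto intro!: derivative_eq_intros)
    show "0 \<le> psi' x" for x by (simp add: psi'_def)
    show "range \<phi> = {0<..}" unfolding \<phi>_def by (rule range_exp_sinh)
    show "mono ?b" using h by (auto simp: mono_def)
    show "filterlim ?b at_top sequentially" using h by real_asymp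
    show "0 \<le> ?b m" for m using b0[of m] by simp
    show "integral {- ?b m..?b m} (\<lambda>x. norm (psi' x *\<^sub>R f (of_real (\<phi> x)))) \<le> K * (pi/2) * (2 / (pi/2 * \<mu>))" for m
    proof -
      have "continuous_on (strip d) (de_integrand f)"
        using f by (intro holomorphic_on_imp_continuous_on holomorphic_on_de_integrand)
      then have "continuous_on S (\<lambda>x. de_integrand f (of_real x))" for S
        by (rule continuous_on_compose2) (auto intro!: continuous_intros simp: real_in)
      then have "integral {- ?b m..?b m} (\<lambda>x. norm (de_integrand f (of_real x)))
        \<le> integral {- ?b m..?b m} (\<lambda>x. K * (pi/2) * (cosh x * exp (- (pi/2 * \<mu>) * \<bar>sinh x\<bar>)))"
      proof (intro integral_le integrable_continuous_real continuous_intros)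
        fix x
        \<comment> \<open>The strip bound at height 0, where both cosine factors become 1.\<close>
        show "norm (de_integrand f (of_real x)) \<le> K * (pi/2) * (cosh x * exp (- (pi/2 * \<mu>) * \<bar>sinh x\<bar>))"
          using de_integrand_bound_uniform[OF K \<alpha> \<beta> d(2,1) bound, of 0 x]
          by (simp add: \<mu>_def complex_of_real_def)
      qed
      also have "\<dots> = K * (pi/2) * integral {- ?b m..?b m} (\<lambda>x. cosh x * exp (- (pi/2 * \<mu>) * \<bar>sinh x\<bar>))"
        by (rule integral_mult_right)
      also have "\<dots> \<le> K * (pi/2) * (2 / (pi/2 * \<mu>))"
        using K b0[of m] by (intro mult_left_mono integral_cosh_exp_abs_sinh_le \<mu>) auto
      finally show ?thesis by (simp only: F)
    qed
  qed
  then show ?thesis by (simp only: F)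
qed

text \<open>For fixed \<open>\<delta>\<close> the symmetric sum over \<open>-m..m\<close> is
  compared with the integral over a widening rectangle, and the terms outside \<open>-M..N\<close>
  are charged to \<open>T1\<close> and \<open>T2\<close>. These bounds do not depend on
  \<open>m\<close>, so they survive the limit.\<close>

lemma de_quadrature_error_le:
  fixes K \<alpha> \<beta> d h \<delta> T1 T2 :: real and M N :: int
  assumes K: "0 < K" and \<alpha>: "0 < \<alpha>" and \<beta>: "0 < \<beta>" and d: "0 < d" "d < pi/2"
    and f: "f analytic_on (psi ` strip d)"
    and bound: "\<And>z. z \<in> psi ` strip d \<Longrightarrow>
        cmod (f z) \<le> K * cmod (z powr (of_real (\<alpha> - 1)) / (1 + z^2) powr (of_real ((\<alpha> + \<beta>)/2)))"
    and h: "0 < h" and \<delta>: "0 < \<delta>" "\<delta> < d" and MN: "0 \<le> M" "0 \<le> N"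
    and T1: "\<And>m. N \<le> m \<Longrightarrow> h * (\<Sum>k\<in>{N+1..m}. cmod (de_integrand f (of_real (of_int k * h)))) \<le> T1"
    and T2: "\<And>m. M \<le> m \<Longrightarrow> h * (\<Sum>k\<in>{M+1..m}. cmod (de_integrand f (of_real (- (of_int k * h))))) \<le> T2"
  shows "cmod (integral {0<..} (\<lambda>t. f (of_real t)) - of_real h * (\<Sum>k\<in>{-M..N}. de_integrand f (of_real (of_int k * h))))
    \<le> 2 / (exp (2 * pi * \<delta> / h) - 1) * (K * (pi/2) / cos (pi/2 * sin \<delta>) powr ((\<alpha> + \<beta>)/2) * (2 / (pi/2 * min \<alpha> \<beta> * cos \<delta>)))
      + T1 + T2"
proof -
  define F where "F = de_integrand f"
  define b where "b = (\<lambda>m. (real m + 1/2) * h)"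
  define \<kappa> where "\<kappa> = pi/2 * min \<alpha> \<beta> * cos \<delta>"
  define B0 where "B0 = K * (pi/2) / cos (pi/2 * sin \<delta>) powr ((\<alpha> + \<beta>)/2)"
  define B where "B = (\<lambda>x. B0 * (cosh x * exp (- \<kappa> * \<bar>sinh x\<bar>)))"
  define P where "P = (\<lambda>k::int. F (of_real (of_int k * h)))"
  define q where "q = exp (2 * pi * \<delta> / h)"
  define I where "I = (\<lambda>m. integral {- b m..b m} (\<lambda>x. F (of_real x)))"
  have b0: "0 < b m" for m using h by (simp add: b_def)
  have \<kappa>: "0 < \<kappa>" using \<alpha> \<beta> \<delta> d by (simp add: \<kappa>_def cos_gt_zero)
  have B0: "0 \<le> B0" using K by (simp add: B0_def)
  have q: "1 < q" using h \<delta> by (simp add: q_def)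
  have I: "I \<longlonglongrightarrow> integral {0<..} (\<lambda>t. f (of_real t))"
    unfolding I_def F_def b_def by (rule tendsto_integral_de_integrand[OF K \<alpha> \<beta> d f bound h])
  have lim: "(\<lambda>m. cmod (I m - of_real h * sum P {-M..N})) \<longlonglongrightarrow>
      cmod (integral {0<..} (\<lambda>t. f (of_real t)) - of_real h * sum P {-M..N})"
    by (intro tendsto_intros I)
  \<comment> \<open>The contribution of the vertical sides vanishes as the rectangle widens;
    \<open>B\<close> is even, so one limit serves both ends.\<close>
  have limB: "(\<lambda>m. 2 / (q - 1) * (B0 * (2 / \<kappa>)) + 3 * \<delta> * (B (b m) + B (- b m)) + T1 + T2)
      \<longlonglongrightarrow> 2 / (q - 1) * (B0 * (2 / \<kappa>)) + 3 * \<delta> * (B0 * 0 + B0 * 0) + T1 + T2"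
  proof -
    have "filterlim b at_top sequentially" unfolding b_def using h by real_asymp
    from filterlim_compose[OF tendsto_cosh_exp_abs_sinh[OF \<kappa>] this]
    have *: "(\<lambda>m. cosh (b m) * exp (- \<kappa> * \<bar>sinh (b m)\<bar>)) \<longlonglongrightarrow> 0" .
    have "B (- x) = B x" for x by (simp add: B_def)
    then show ?thesis unfolding B_def by (intro tendsto_intros) (use * in simp_all)
  qed
  have "cmod (I m - of_real h * sum P {-M..N})
      \<le> 2 / (q - 1) * (B0 * (2 / \<kappa>)) + 3 * \<delta> * (B (b m) + B (- b m)) + T1 + T2"
    if m: "m \<ge> nat (max M N)" for m
  proof -
    have mMN: "M \<le> int m" "N \<le> int m" using m by auto
    have 1: "cmod (I m - of_real h * sum P {- int m..int m})
        \<le> 2 / (q - 1) * integral {- b m..b m} B + 3 * \<delta> * (B (b m) + B (- b m))"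
      unfolding I_def P_def q_def b_def
    proof (rule trapezoidal_error_strip[OF h \<delta>])
      show "F holomorphic_on strip d" unfolding F_def using f by (rule holomorphic_on_de_integrand)
      show "cmod (F (Complex x y)) \<le> B x" if "\<bar>y\<bar> \<le> \<delta>" for x y
        using de_integrand_bound_uniform[OF K \<alpha> \<beta> d(2) \<delta>(2) bound that]
        unfolding F_def B_def B0_def \<kappa>_def .
      show "continuous_on UNIV B" unfolding B_def by (intro continuous_intros)
    qed
    have "integral {- b m..b m} B = B0 * integral {- b m..b m} (\<lambda>x. cosh x * exp (- \<kappa> * \<bar>sinh x\<bar>))"
      unfolding B_def by (rule integral_mult_right)
    also have "\<dots> \<le> B0 * (2 / \<kappa>)"
      using b0[of m] by (intro mult_left_mono B0 integral_cosh_exp_abs_sinh_le \<kappa>) auto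
    finally have "integral {- b m..b m} B \<le> B0 * (2 / \<kappa>)" .
    then have 2: "2 / (q - 1) * integral {- b m..b m} B \<le> 2 / (q - 1) * (B0 * (2 / \<kappa>))"
      using q by (intro mult_left_mono) auto
    \<comment> \<open>Nonnegative \<open>M\<close> and \<open>N\<close> keep the three blocks
      disjoint and make them cover the whole range.\<close>
    have "{- int m..int m} = {- int m..-M-1} \<union> ({-M..N} \<union> {N+1..int m})"
      using mMN MN by auto
    then have S: "sum P {- int m..int m} = sum P {- int m..-M-1} + (sum P {-M..N} + sum P {N+1..int m})"
      using MN by (simp only:) (subst sum.union_disjoint; (subst sum.union_disjoint)?; auto)
    have "norm (sum P {N+1..int m}) \<le> (\<Sum>k\<in>{N+1..int m}. norm (P k))" by (rule norm_sum)
    then have "h * norm (sum P {N+1..int m}) \<le> h * (\<Sum>k\<in>{N+1..int m}. norm (P k))"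
      using h by (intro mult_left_mono) auto
    also have "\<dots> \<le> T1" using T1[OF mMN(2)] unfolding P_def F_def .
    finally have 3: "h * norm (sum P {N+1..int m}) \<le> T1" .
    have "norm (sum P {- int m..-M-1}) \<le> (\<Sum>k\<in>{- int m..-M-1}. norm (P k))" by (rule norm_sum)
    also have "\<dots> = (\<Sum>k\<in>{M+1..int m}. norm (P (-k)))"
      by (rule sum.reindex_bij_witness[of _ uminus uminus]) auto
    finally have "h * norm (sum P {- int m..-M-1}) \<le> h * (\<Sum>k\<in>{M+1..int m}. norm (P (-k)))"
      using h by (intro mult_left_mono) auto
    also have "\<dots> \<le> T2" using T2[OF mMN(1)] unfolding P_def F_def by simp
    finally have 4: "h * norm (sum P {- int m..-M-1}) \<le> T2" .
    have "I m - of_real h * sum P {-M..N} = (I m - of_real h * sum P {- int m..int m})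
        + of_real h * sum P {- int m..-M-1} + of_real h * sum P {N+1..int m}"
      unfolding S by (simp add: distrib_left)
    then have "cmod (I m - of_real h * sum P {-M..N}) \<le> cmod (I m - of_real h * sum P {- int m..int m})
        + cmod (of_real h * sum P {- int m..-M-1}) + cmod (of_real h * sum P {N+1..int m})"
      by (metis norm_triangle_mono norm_triangle_ineq order_refl)
    moreover have "cmod (of_real h * x) = h * cmod x" for x using h by (simp add: norm_mult)
    ultimately show ?thesis using 1 2 3 4 by simp
  qed
  then have "\<forall>\<^sub>F m in sequentially. cmod (I m - of_real h * sum P {-M..N})
      \<le> 2 / (q - 1) * (B0 * (2 / \<kappa>)) + 3 * \<delta> * (B (b m) + B (- b m)) + T1 + T2"
    by (rule eventually_sequentiallyI)
  from tendsto_le[OF _ limB lim this] show ?thesis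
    by (simp add: P_def F_def q_def B0_def \<kappa>_def)
qed

theorem theorem8:
  fixes d K \<alpha> \<beta> :: real and f :: "complex \<Rightarrow> complex" and n :: nat
  assumes hd: "0 < d" "d < pi/2"
    and hf: "f analytic_on (psi ` strip d)"
    and hK: "0 < K" and h\<alpha>: "0 < \<alpha>" and h\<beta>: "0 < \<beta>"
    and hbound: "\<And>z. z \<in> psi ` strip d \<Longrightarrow>
        cmod (f z) \<le> K * cmod (z powr (of_real (\<alpha> - 1)) / (1 + z^2) powr (of_real ((\<alpha> + \<beta>)/2)))"
    and hn: "0 < n"
    and hn2: "real n \<ge> max \<alpha> \<beta> * exp 1 / (8*d)"
    and hM: "real_of_int (if min \<alpha> \<beta> = \<alpha> then int n
                  else int n - \<lfloor>ln (\<alpha>/\<beta>) / (ln (8*d*n/min \<alpha> \<beta>)/n)\<rfloor>)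
              * (ln (8*d*n/min \<alpha> \<beta>)/n) \<ge> x_gamma (\<alpha>/2)"
    and hN: "real_of_int (if min \<alpha> \<beta> = \<alpha> then int n - \<lfloor>ln (\<beta>/\<alpha>) / (ln (8*d*n/min \<alpha> \<beta>)/n)\<rfloor>
                  else int n)
              * (ln (8*d*n/min \<alpha> \<beta>)/n) \<ge> x_gamma (\<beta>/2)"
  shows "let \<mu> = min \<alpha> \<beta>; \<nu> = max \<alpha> \<beta>; h = ln (8*d*n/\<mu>)/n;
             M = (if \<mu> = \<alpha> then int n else int n - \<lfloor>ln (\<alpha>/\<beta>)/h\<rfloor>);
             N = (if \<mu> = \<alpha> then int n - \<lfloor>ln (\<beta>/\<alpha>)/h\<rfloor> else int n);
             C2 = 2*K/\<mu> * (2 / ((1 - exp (-pi*\<mu>*exp 1/4))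
                    * (cos (pi/2 * sin d)) powr ((\<alpha>+\<beta>)/2) * cos d) + exp (pi*\<nu>/4))
         in cmod (integral {0<..} (\<lambda>t. f (of_real t))
                  - of_real h * (\<Sum>k\<in>{-M..N}. f (psi (of_real (real_of_int k * h))) * of_real (psi' (real_of_int k * h))))
            \<le> C2 * exp (-2*pi*d*n / ln (8*d*n/\<mu>))"
proof -
  define \<mu> \<nu> where "\<mu> = min \<alpha> \<beta>" and "\<nu> = max \<alpha> \<beta>"
  define L where "L = ln (8 * d * n / \<mu>)"
  define h where "h = L / n"
  define M where "M = (if \<mu> = \<alpha> then int n else int n - \<lfloor>ln (\<alpha>/\<beta>)/h\<rfloor>)"
  define N where "N = (if \<mu> = \<alpha> then int n - \<lfloor>ln (\<beta>/\<alpha>)/h\<rfloor> else int n)"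
  \<comment> \<open>\<open>e\<close> is the convergence factor of the claim, not Euler's number.
    \<open>T\<close> bounds either tail, and \<open>R\<close> is the discretization error at height
    \<open>\<delta>\<close>.\<close>
  define e where "e = exp (- (2 * pi * d * n) / L)"
  define T where "T = K / \<mu> * (exp (pi * \<nu> / 4) * e)"
  define R where "R = (\<lambda>\<delta>. 2 / (exp (2 * pi * \<delta> / h) - 1) * (K * (pi/2) / cos (pi/2 * sin \<delta>) powr ((\<alpha> + \<beta>)/2) * (2 / (pi/2 * \<mu> * cos \<delta>))))"
  define E where "E = cmod (integral {0<..} (\<lambda>t. f (of_real t)) - of_real h * (\<Sum>k\<in>{-M..N}. de_integrand f (of_real (of_int k * h))))"
  have \<mu>: "0 < \<mu>" "\<mu> \<le> \<alpha>" "\<mu> \<le> \<beta>" "\<mu> \<le> \<nu>" and \<nu>: "\<alpha> \<le> \<nu>" "\<beta> \<le> \<nu>"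
    using h\<alpha> h\<beta> by (auto simp: \<mu>_def \<nu>_def)
  have dn: "\<nu> * exp 1 \<le> 8 * d * n" using hn2 hd by (simp add: \<nu>_def field_simps)
  have dn0: "0 < 8 * d * n" using hd hn by simp
  have Yge: "exp 1 \<le> 8 * d * n / \<gamma>" if "0 < \<gamma>" "\<gamma> \<le> \<nu>" for \<gamma>
  proof -
    have "\<gamma> * exp 1 \<le> \<nu> * exp 1" using that by (intro mult_right_mono) auto
    with dn have "\<gamma> * exp 1 \<le> 8 * d * n" by linarith
    then show ?thesis using that by (simp add: pos_le_divide_eq mult.commute)
  qed
  have X: "exp 1 \<le> 8 * d * n / \<mu>" using Yge \<mu> by auto
  have L1: "1 \<le> L" unfolding L_def using X dn0 \<mu> by (subst ln_ge_iff) auto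
  have h0: "0 < h" using L1 hn by (simp add: h_def)
  have nh: "real n * h = L" using hn by (simp add: h_def)
  \<comment> \<open>The end that is not shortened sits at \<open>n * h = L\<close>. At the other
    end, rounding the shift down only lengthens the sum, and \<open>L\<close> minus the log ratio is
    \<open>ln (8*d*n/\<beta>)\<close> or \<open>ln (8*d*n/\<alpha>)\<close> respectively.\<close>
  have Nh: "ln (8 * d * n / \<beta>) \<le> of_int N * h" and Mh: "ln (8 * d * n / \<alpha>) \<le> of_int M * h"
  proof -
    have floor: "L - x \<le> of_int (int n - \<lfloor>x / h\<rfloor>) * h" for x
    proof -
      have "of_int \<lfloor>x / h\<rfloor> * h \<le> x / h * h" using h0 by (intro mult_right_mono) auto
      then show ?thesis using h0 nh by (simp add: left_diff_distrib)
    qed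
    have ln1: "L = ln (8 * d * n) - ln \<mu>" "ln (8 * d * n / \<beta>) = ln (8 * d * n) - ln \<beta>"
      "ln (8 * d * n / \<alpha>) = ln (8 * d * n) - ln \<alpha>" "ln (\<alpha>/\<beta>) = ln \<alpha> - ln \<beta>" "ln (\<beta>/\<alpha>) = ln \<beta> - ln \<alpha>"
      unfolding L_def using hd hn \<mu> h\<alpha> h\<beta> by (simp_all add: ln_div)
    \<comment> \<open>For equal \<alpha> and \<beta> the definitions of \<open>M\<close> and
      \<open>N\<close> take their first branch, hence the asymmetric case split.\<close>
    have "(\<mu> = \<alpha>) \<or> (\<mu> \<noteq> \<alpha> \<and> \<mu> = \<beta>)" by (auto simp: \<mu>_def min_def)
    then show "ln (8 * d * n / \<beta>) \<le> of_int N * h" "ln (8 * d * n / \<alpha>) \<le> of_int M * h"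
      using floor[of "ln (\<alpha>/\<beta>)"] floor[of "ln (\<beta>/\<alpha>)"] nh ln1 by (auto simp: N_def M_def)
  qed
  have ln_ge1: "1 \<le> ln (8 * d * n / \<gamma>)" if "0 < \<gamma>" "\<gamma> \<le> \<nu>" for \<gamma>
    using Yge[OF that] dn0 that by (subst ln_ge_iff) auto
  have "0 < of_int N * h" "0 < of_int M * h"
    using Nh Mh ln_ge1[OF h\<alpha> \<nu>(1)] ln_ge1[OF h\<beta> \<nu>(2)] by linarith+
  then have MN: "0 \<le> M" "0 \<le> N" using h0 by (auto simp: zero_less_mult_iff)
  have xM: "x_gamma (\<alpha>/2) \<le> of_int M * h" and xN: "x_gamma (\<beta>/2) \<le> of_int N * h"
    using hM hN unfolding M_def N_def h_def L_def \<mu>_def by simp_all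
  \<comment> \<open>One statement for both ends: \<gamma> cancels in the exponent, and the
    prefactors are at worst \<open>K / \<mu>\<close> and
    \<open>exp (pi * \<nu> / 4)\<close>.\<close>
  have tail: "h * sum G {N'+1..m} \<le> T"
    if \<gamma>: "0 < \<gamma>" "\<mu> \<le> \<gamma>" "\<gamma> \<le> \<nu>" and N': "ln (8 * d * n / \<gamma>) \<le> of_int N' * h" "x_gamma (\<gamma>/2) \<le> of_int N' * h" "N' \<le> m"
      and G: "\<And>k. G k \<le> K * (pi/2) * (cosh (of_int k * h) * exp (- (pi/2 * \<gamma>) * sinh (of_int k * h)))"
    for \<gamma> N' m G
  proof -
    have "8 * d * n / \<gamma> = exp (ln (8 * d * n / \<gamma>))" using dn0 \<gamma> by simp
    also have "\<dots> \<le> exp (of_int N' * h)" using N' by simp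
    finally have Y: "8 * d * n / \<gamma> \<le> exp (of_int N' * h)" .
    have LL: "ln (8 * d * n / \<gamma>) \<le> L"
      unfolding L_def using dn0 \<gamma> \<mu> by (subst ln_le_cancel_iff) (auto intro!: divide_left_mono)
    have eq: "pi * \<gamma> * (8 * d * n / \<gamma>) / 4 = 2 * pi * d * n" using \<gamma> by simp
    have "h * sum G {N'+1..m} \<le> K / \<gamma> * (exp (pi * \<gamma> / 4) * e)"
      using exp_sinh_tail_sum_bound[OF h0 hK \<gamma>(1) N'(2) Yge[OF \<gamma>(1,3)] Y LL N'(3) G]
      unfolding eq e_def .
    also have "\<dots> \<le> T"
      unfolding T_def using hK \<gamma> \<mu> by (intro mult_mono divide_left_mono) (auto simp: e_def)
    finally show ?thesis .
  qed
  have ER: "E \<le> R \<delta> + T + T" if \<delta>: "0 < \<delta>" "\<delta> < d" for \<delta>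
    unfolding E_def R_def \<mu>_def
  proof (rule de_quadrature_error_le[OF hK h\<alpha> h\<beta> hd hf hbound h0 \<delta> MN])
    \<comment> \<open>The sample points are real, so the bound is taken at height 0. At
      \<open>-x\<close> the sign of sinh flips and the left-end rate \<alpha> takes the place of
      \<beta>.\<close>
    note bnd = de_integrand_bound[OF hK h\<alpha> h\<beta> hd(2,1) hbound]
    have b1: "cmod (de_integrand f (of_real x)) \<le> K * (pi/2) * (cosh x * exp (- (pi/2 * \<beta>) * sinh x))" for x
      using bnd(1)[of "of_real x"] by (simp add: Re_sinh)
    have b2: "cmod (de_integrand f (of_real (-x))) \<le> K * (pi/2) * (cosh x * exp (- (pi/2 * \<alpha>) * sinh x))" for x
      using bnd(2)[of "of_real (-x)"] by (simp add: Re_sinh)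
    show "h * (\<Sum>k\<in>{N+1..m}. cmod (de_integrand f (of_real (of_int k * h)))) \<le> T" if "N \<le> m" for m
      by (rule tail[OF h\<beta> \<mu>(3) \<nu>(2) Nh xN that b1])
    show "h * (\<Sum>k\<in>{M+1..m}. cmod (de_integrand f (of_real (- (of_int k * h))))) \<le> T" if "M \<le> m" for m
      by (rule tail[OF h\<alpha> \<mu>(2) \<nu>(1) Mh xM that b2])
  qed

  \<comment> \<open>Letting \<open>\<delta>\<close> tend to \<open>d\<close> and collecting the
    constants\<close>
  have Cd: "0 < cos (pi/2 * sin d)" using hd by (intro cos_half_pi_sin_pos) auto
  have cd: "0 < cos d" using hd by (intro cos_gt_zero) auto
  define q where "q = exp (2 * pi * d / h)"
  have q1: "1 < q" using hd h0 by (simp add: q_def)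
  \<comment> \<open>\<open>E\<close> does not involve \<open>\<delta>\<close>, and the denominators
    of \<open>R\<close> stay positive at \<open>d\<close>, so the bound extends to height
    \<open>d\<close> itself.\<close>
  have "(R \<longlongrightarrow> R d) (at_left d)"
    unfolding R_def using Cd cd h0 \<mu> hd by (intro tendsto_intros) auto
  then have "((\<lambda>\<delta>. R \<delta> + T + T) \<longlongrightarrow> R d + T + T) (at_left d)"
    by (intro tendsto_intros)
  moreover have "\<forall>\<^sub>F \<delta> in at_left d. E \<le> R \<delta> + T + T"
    using eventually_at_left_real[OF hd(1)] by (rule eventually_mono) (simp only: ER greaterThanLessThan_iff)
  ultimately have Ed: "E \<le> R d + T + T"
    by (rule tendsto_lowerbound) auto
  have eq: "e = 1 / q"
    unfolding e_def q_def h_def using hn by (simp add: exp_minus inverse_eq_divide)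
  define e0 where "e0 = exp (- pi * \<mu> * exp 1 / 4)"
  have e0: "e0 < 1" unfolding e0_def using \<mu> by simp
  \<comment> \<open>From \<open>ln Y \<le> Y / exp 1\<close> with \<open>Y = 8*d*n/\<mu>\<close>,
    the quotient \<open>Y / L\<close> is at least Euler's number. This makes \<open>e\<close> at
    most a constant below 1, so \<open>1 / (q - 1) = e / (1 - e)\<close> is at most
    \<open>e / (1 - e0)\<close>.\<close>
  have ee0: "e \<le> e0"
  proof -
    have "ln (8 * d * n / \<mu> / exp 1) \<le> 8 * d * n / \<mu> / exp 1 - 1"
      using dn0 \<mu> by (intro ln_le_minus_one) auto
    then have "L \<le> 8 * d * n / \<mu> / exp 1" unfolding L_def using hd hn \<mu> by (simp add: ln_div ln_mult)
    then have "\<mu> * exp 1 * L \<le> 8 * d * n" using \<mu> by (simp add: field_simps)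
    then have "pi / 4 * (\<mu> * exp 1 * L) \<le> pi / 4 * (8 * d * n)"
      by (intro mult_left_mono) auto
    then have "pi * \<mu> * exp 1 / 4 \<le> 2 * pi * d * n / L" using L1 by (simp add: field_simps)
    then show ?thesis by (simp add: e_def e0_def)
  qed
  define Q where "Q = cos (pi/2 * sin d) powr ((\<alpha> + \<beta>)/2)"
  have Q: "0 < Q" using Cd by (simp add: Q_def)
  have "R d = 4 * K / (\<mu> * Q * cos d) * (1 / (q - 1))"
    unfolding R_def Q_def[symmetric] q_def[symmetric] using \<mu> Q cd q1 by (simp add: field_simps)
  also have "\<dots> \<le> 4 * K / (\<mu> * Q * cos d) * (e / (1 - e0))"
  proof (intro mult_left_mono)
    have "1 / (q - 1) = e / (1 - e)" unfolding eq using q1 by (simp add: field_simps)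
    moreover have "0 \<le> e" by (simp add: e_def)
    then have "e / (1 - e) \<le> e / (1 - e0)" using ee0 e0 by (intro divide_left_mono mult_pos_pos) auto
    ultimately show "1 / (q - 1) \<le> e / (1 - e0)" by simp
  qed (use hK \<mu> Q cd in auto)
  also have "\<dots> = 2 * K / \<mu> * (2 / ((1 - e0) * Q * cos d)) * e"
    by simp
  finally have "E \<le> 2 * K / \<mu> * (2 / ((1 - e0) * Q * cos d)) * e + T + T"
    using Ed by linarith
  also have "\<dots> = 2 * K / \<mu> * (2 / ((1 - e0) * Q * cos d) + exp (pi * \<nu> / 4)) * e"
    unfolding T_def by (simp add: distrib_left distrib_right)
  finally have fin: "E \<le> 2 * K / \<mu> * (2 / ((1 - e0) * Q * cos d) + exp (pi * \<nu> / 4)) * e" .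
  have "e = exp (- 2 * pi * d * n / L)" by (simp add: e_def)
  with fin show ?thesis
    unfolding Let_def \<mu>_def[symmetric] \<nu>_def[symmetric] L_def[symmetric] h_def[symmetric] M_def[symmetric] N_def[symmetric]
      e0_def[symmetric] Q_def[symmetric] de_integrand_of_real[symmetric] E_def[symmetric]
    by simp
qed

end
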